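(* Let $G\in\mathbb{G}$. Then: (1) $\mu_G(U)>0$ for any non-empty (relatively) open set $U\subset\Delta_m$. (2) $\mu_G$ has no atoms.
   Context: Let $\Sigma=\{1,\ldots,m\}$ with $m\ge 2$. $\mathbb{G}$ is the set of real $m\times m$ matrices $G$ with $G(i,j)>0$ for all distinct $i,j$ and $G(i,i)=-\sum_{j\ne i}G(i,j)$. For $G\in\mathbb{G}$, put $n(G)=\lceil\max_i|G(i,i)|\rceil$, $P^G_n=I$ for $1\le n\le n(G)$ and $P^G_n=I+G/n$ for $n\ge n(G)+1$. Let $(X_n)_{n\ge0}$ be the time-nonhomogeneous Markov chain on $\Sigma$ with some initial distribution $\pi$ and transition matrix $P^G_{n+1}$ between times $n$ and $n+1$, and let $\mathbf{Z}_n=\langle Z_{1,n},\ldots,Z_{m,n}\rangle$, $Z_{i,n}=\frac1n\sum_{k=1}^n1_i(X_k)$, with values in the simplex $\Delta_m=\{\mathbf{x}\in[0,1]^m:\sum_i x_i=1\}$. Then $\mu_G$ denotes the probability measure on $\Delta_m$ which is the limit in distribution of $\mathbf{Z}_n$ (it exists and does not depend on $\pi$). It is characterized by its moments: $E_{\mu_G}(x_i)=\nu_G(i)$ and, for integers $\gamma_1,\ldots,\gamma_m\ge0$ with $\bar\gamma=\sum_i\gamma_i\ge2$, $$E_{\mu_G}(x_1^{\gamma_1}\cdots x_m^{\gamma_m})=\frac1{\bar\gamma}\sum_{\sigma\in\mathbb{S}(\gamma_1,\ldots,\gamma_m)}\nu_G(\sigma_1)\prod_{i=1}^{\bar\gamma-1}(iI-G)^{-1}(\sigma_i,\sigma_{i+1}),$$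 where $\nu_G$ is the unique left eigenvector of $G$ for eigenvalue $0$ with positive entries summing to $1$, and $\mathbb{S}(\gamma_1,\ldots,\gamma_m)$ is the collection of all $\bar\gamma!$ permutations (with multiplicity) of the list with $\gamma_k$ copies of $k$ for each $1\le k\le m$. *)

theory Defs
  imports "HOL-Probability.Probability"
begin

text \<open>The state space is a finite type \<open>'m\<close>, whose cardinality plays the role of \<open>m\<close>;
  matrix entries are \<open>G(i,j) = G $ i $ j\<close>.\<close>

definition generators :: "(real ^ 'm ^ 'm) set" where
  "generators = {G. (\<forall>i j. i \<noteq> j \<longrightarrow> G $ i $ j > 0) \<and>
                    (\<forall>i. G $ i $ i = - (\<Sum>j\<in>UNIV - {i}. G $ i $ j))}"

definition start_index :: "real ^ 'm ^ 'm \<Rightarrow> nat" where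
  "start_index G = nat \<lceil>MAX i. \<bar>G $ i $ i\<bar>\<rceil>"

text \<open>The value at \<open>n = 0\<close> is irrelevant: the chain below only uses indices \<open>n \<ge> 1\<close>.\<close>

definition trans_matrix :: "real ^ 'm ^ 'm \<Rightarrow> nat \<Rightarrow> real ^ 'm ^ 'm" where
  "trans_matrix G n = (if n \<le> start_index G then mat 1 else mat 1 + (1 / real n) *\<^sub>R G)"

text \<open>\<open>P (Suc n)\<close> is the transition matrix between times \<open>n\<close> and \<open>n + 1\<close>; conditioning is only
  required on histories of positive probability.\<close>

definition markov_chain ::
  "'w measure \<Rightarrow> (nat \<Rightarrow> 'w \<Rightarrow> 'm) \<Rightarrow> 'm pmf \<Rightarrow> (nat \<Rightarrow> real ^ 'm ^ 'm) \<Rightarrow> bool" where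
  "markov_chain M X \<pi> P \<longleftrightarrow>
     prob_space M \<and>
     (\<forall>n. X n \<in> measurable M (count_space UNIV)) \<and>
     (\<forall>i. \<P>(\<omega> in M. X 0 \<omega> = i) = pmf \<pi> i) \<and>
     (\<forall>n s. \<P>(\<omega> in M. \<forall>k\<le>n. X k \<omega> = s k) > 0 \<longrightarrow>
        \<P>(\<omega> in M. X (Suc n) \<omega> = s (Suc n) \<bar> \<forall>k\<le>n. X k \<omega> = s k) = P (Suc n) $ s n $ s (Suc n))"

definition occupation :: "(nat \<Rightarrow> 'w \<Rightarrow> 'm) \<Rightarrow> nat \<Rightarrow> 'w \<Rightarrow> real ^ 'm" where
  "occupation X n \<omega> = (\<chi> i. (1 / real n) * (\<Sum>k=1..n. indicator {i} (X k \<omega>)))"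

definition prob_simplex :: "(real ^ 'm) set" where
  "prob_simplex = {x. (\<forall>i. x $ i \<in> {0..1}) \<and> (\<Sum>i\<in>UNIV. x $ i) = 1}"

definition prob_measure_on :: "'a::topological_space set \<Rightarrow> 'a measure \<Rightarrow> bool" where
  "prob_measure_on S \<mu> \<longleftrightarrow> prob_space \<mu> \<and> sets \<mu> = sets (restrict_space borel S)"

text \<open>Test functions are bounded and continuous on \<open>S\<close> only. The \<open>Y n\<close> are meant to take values
  in \<open>S\<close> for all large \<open>n\<close>; \<open>occupation X n\<close> lies in \<open>prob_simplex\<close> for \<open>n \<ge> 1\<close>.\<close>

definition limit_in_distribution ::
  "'a::topological_space set \<Rightarrow> 'w measure \<Rightarrow> (nat \<Rightarrow> 'w \<Rightarrow> 'a) \<Rightarrow> 'a measure \<Rightarrow> bool" where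
  "limit_in_distribution S M Y \<mu> \<longleftrightarrow>
     prob_measure_on S \<mu> \<and>
     (\<forall>f :: 'a \<Rightarrow> real. continuous_on S f \<and> bounded (f ` S) \<longrightarrow>
        (\<lambda>n. \<integral>\<omega>. f (Y n \<omega>) \<partial>M) \<longlonglongrightarrow> (\<integral>x. f x \<partial>\<mu>))"

end

theory Submission imports Defs begin

text \<open>The limit law is studied through the chain itself. A jump at time \<open>k\<close> has probability of
  order \<open>1 / k\<close>, so between \<open>\<delta> n\<close> and \<open>n\<close> only boundedly many jumps are expected.

  Full support: for \<open>N\<close> proportional to \<open>n\<close>, the chain rests in a state \<open>i\<close> on the whole of \<open>(N, n]\<close> with
  probability bounded below, which moves the occupation vector along the segment towards the
  vertex \<open>e\<^sub>i\<close>; and an arbitrarily short proportion of the time suffices to switch to any other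
  state with probability bounded below. Starting from anywhere, segments towards vertices reach
  first a neighbourhood of each vertex and then of each point of the simplex.

  No atoms: let \<open>k < n\<close> be the last time at which the chain leaves or enters \<open>i\<close>. If it leaves, the
  number \<open>S\<^sub>n\<close> of visits to \<open>i\<close> equals \<open>S\<^sub>k\<close>; if it enters, the number of visits elsewhere
  is frozen at time \<open>k\<close>. Since \<open>S\<close> increases at each visit, a set \<open>W\<close> of values of \<open>S\<^sub>n\<close> leaves at
  most \<open>card W\<close> candidates for \<open>k\<close> of either kind, each of probability \<open>O(1 / k)\<close>.\<close>

section \<open>Predicates on paths decided by finitely many coordinates\<close>

text \<open>Plays the part of the sigma-algebra of the past: since the state space is finite, every
  predicate of this kind turns out to be an event, so no filtration has to be set up.\<close>

definition hist :: "nat \<Rightarrow> ((nat \<Rightarrow> 'm) \<Rightarrow> bool) \<Rightarrow> bool" where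
  "hist n R \<longleftrightarrow> (\<forall>s t. (\<forall>k\<le>n. s k = t k) \<longrightarrow> R s = R t)"

lemma histD: "hist n R \<Longrightarrow> (\<And>k. k \<le> n \<Longrightarrow> s k = t k) \<Longrightarrow> R s = R t"
  by (auto simp: hist_def)

lemma hist_mono: "hist n R \<Longrightarrow> n \<le> m \<Longrightarrow> hist m R"
  by (auto simp: hist_def)

lemma hist_coord: "k \<le> n \<Longrightarrow> hist n (\<lambda>s. Q (s k))"
  by (auto simp: hist_def)

lemma hist_conj: "hist n R \<Longrightarrow> hist n Q \<Longrightarrow> hist n (\<lambda>s. R s \<and> Q s)"
  unfolding hist_def by blast

lemma hist_disj: "hist n R \<Longrightarrow> hist n Q \<Longrightarrow> hist n (\<lambda>s. R s \<or> Q s)"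
  unfolding hist_def by blast

lemma hist_not: "hist n R \<Longrightarrow> hist n (\<lambda>s. \<not> R s)"
  unfolding hist_def by blast

lemma hist_ball: "(\<And>k. k \<in> A \<Longrightarrow> hist n (R k)) \<Longrightarrow> hist n (\<lambda>s. \<forall>k\<in>A. R k s)"
  unfolding hist_def by blast

lemma hist_const: "hist n (\<lambda>s. c)"
  by (auto simp: hist_def)

section \<open>Visit counts\<close>

definition visits :: "'m set \<Rightarrow> (nat \<Rightarrow> 'm) \<Rightarrow> nat \<Rightarrow> nat" where
  "visits A s n = card {l \<in> {1..n}. s l \<in> A}"

lemma visits_cong: "(\<And>k. k \<le> n \<Longrightarrow> s k = t k) \<Longrightarrow> visits A s n = visits A t n"
  unfolding visits_def by (intro arg_cong[where f=card]) auto

lemma visits_compl: "visits A s n + visits (-A) s n = n"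
proof -
  have "visits A s n + visits (-A) s n = card ({l \<in> {1..n}. s l \<in> A} \<union> {l \<in> {1..n}. s l \<in> -A})"
    unfolding visits_def by (rule card_Un_disjoint[symmetric]) auto
  also have "{l \<in> {1..n}. s l \<in> A} \<union> {l \<in> {1..n}. s l \<in> -A} = {1..n}"
    by auto
  finally show ?thesis by simp
qed

lemma visits_no_visit:
  assumes "k \<le> n" "\<And>l. l \<in> {k<..n} \<Longrightarrow> s l \<notin> A"
  shows "visits A s n = visits A s k"
proof -
  have "l \<in> {1..n} \<and> s l \<in> A \<longleftrightarrow> l \<in> {1..k} \<and> s l \<in> A" for l
    using assms(1) assms(2)[of l] by (cases "k < l") auto
  then show ?thesis by (simp add: visits_def)
qed

text \<open>A time \<open>k \<ge> 1\<close> spent in \<open>A\<close> is itself counted, so the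
  count rises strictly there. Time 0 is left out because counting starts at time 1.\<close>

lemma inj_on_visits: "inj_on (visits A s) {k \<in> {1..}. s k \<in> A}"
proof (rule linorder_inj_onI)
  fix j k assume "j < k" and jk: "j \<in> {k \<in> {1..}. s k \<in> A}" "k \<in> {k \<in> {1..}. s k \<in> A}"
  then have "k \<in> {l \<in> {1..k}. s l \<in> A}" "k \<notin> {l \<in> {1..j}. s l \<in> A}"
    "{l \<in> {1..j}. s l \<in> A} \<subseteq> {l \<in> {1..k}. s l \<in> A}"
    by auto
  then have "{l \<in> {1..j}. s l \<in> A} \<subset> {l \<in> {1..k}. s l \<in> A}"
    by blast
  then have "visits A s j < visits A s k"
    unfolding visits_def by (intro psubset_card_mono) auto
  then show "visits A s j \<noteq> visits A s k" by simp
qed auto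

text \<open>By \<open>inj_on_visits\<close> each value in \<open>W\<close> is taken at most once at
  a time spent in \<open>A\<close>. The bound is uniform in the path and in \<open>n\<close>, which
  is what the anticoncentration estimate needs.\<close>

lemma card_visit_times:
  assumes "finite W" "1 \<le> a"
  shows "card {k \<in> {a..<n}. visits A s k \<in> W \<and> s k \<in> A} \<le> card W"
proof (rule card_inj_on_le[OF _ _ assms(1)])
  show "inj_on (visits A s) {k \<in> {a..<n}. visits A s k \<in> W \<and> s k \<in> A}"
    using assms(2) by (intro inj_on_subset[OF inj_on_visits]) auto
qed auto

section \<open>Occupation vectors of a path\<close>

text \<open>The occupation vector as an average of unit vectors along a deterministic path; this
  form suits norm estimates and convex combinations.\<close>

definition empirical :: "(nat \<Rightarrow> 'm) \<Rightarrow> nat \<Rightarrow> real ^ 'm" where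
  "empirical s n = (1 / real n) *\<^sub>R (\<Sum>k=1..n. axis (s k) 1)"

lemma empirical_cong: "(\<And>k. k \<le> n \<Longrightarrow> s k = t k) \<Longrightarrow> empirical s n = empirical t n"
  by (simp add: empirical_def)

lemma occupation_eq_empirical: "occupation X n \<omega> = empirical (\<lambda>k. X k \<omega>) n"
proof -
  have "(\<Sum>k=1..n. axis (X k \<omega>) (1 :: real)) $ i = (\<Sum>k=1..n. indicator {i} (X k \<omega>))" for i
    unfolding sum_component by (intro sum.cong refl) (simp add: axis_def indicator_def)
  then show ?thesis
    by (simp add: occupation_def empirical_def vec_eq_iff)
qed

lemma empirical_nth: "empirical s n $ i = real (visits {i} s n) / real n"
proof -
  have "(\<Sum>k=1..n. axis (s k) (1 :: real)) $ i = (\<Sum>k=1..n. of_bool (s k \<in> {i}))"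
    unfolding sum_component by (intro sum.cong refl) (simp add: axis_def)
  also have "\<dots> = real (visits {i} s n)"
    unfolding visits_def by (simp add: sum.If_cases Int_def)
  finally show ?thesis
    by (simp add: empirical_def)
qed

lemma norm_axes_sum_le:
  assumes "finite K"
  shows "norm (\<Sum>k\<in>K. axis (s k) (1 :: real)) \<le> real (card K)"
  using sum_norm_le[of K "\<lambda>k. axis (s k) (1 :: real)" "\<lambda>_. 1"] assms by simp

lemma norm_empirical_le: "norm (empirical s n) \<le> 1"
  using norm_axes_sum_le[of "{1..n}" s] by (cases "n = 0") (auto simp: empirical_def field_simps)

lemma empirical_split:
  assumes "N \<le> n" "0 < N"
  shows "empirical s n =
    (real N / real n) *\<^sub>R empirical s N + (1 / real n) *\<^sub>R (\<Sum>k\<in>{N<..n}. axis (s k) 1)"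
proof -
  have "{1..n} = {1..N} \<union> {N<..n}"
    using assms by auto
  then have "(\<Sum>k=1..n. axis (s k) (1 :: real)) =
      (\<Sum>k=1..N. axis (s k) 1) + (\<Sum>k\<in>{N<..n}. axis (s k) 1)"
    by (simp add: sum.union_disjoint ivl_disj_int)
  then show ?thesis
    using assms by (simp add: empirical_def scaleR_add_right)
qed

text \<open>Reweighting the old average and adding the new unit vectors each move the vector by at
  most \<open>(n - N) / n\<close>.\<close>

lemma dist_empirical_le:
  assumes "N \<le> n" "0 < N"
  shows "dist (empirical s n) (empirical s N) \<le> 2 * (real n - real N) / real n"
proof -
  have "empirical s n - empirical s N = (real N / real n - 1) *\<^sub>R empirical s N +
      (1 / real n) *\<^sub>R (\<Sum>k\<in>{N<..n}. axis (s k) 1)"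
    using assms by (simp add: empirical_split[of N n] scaleR_diff_left)
  also have "norm \<dots> \<le> \<bar>real N / real n - 1\<bar> * norm (empirical s N) +
      (1 / real n) * norm (\<Sum>k\<in>{N<..n}. axis (s k) (1 :: real))"
    using norm_triangle_ineq by (rule order_trans) simp
  also have "\<dots> \<le> \<bar>real N / real n - 1\<bar> * 1 + (1 / real n) * real (card {N<..n})"
    by (intro add_mono mult_left_mono norm_empirical_le norm_axes_sum_le) auto
  also have "\<bar>real N / real n - 1\<bar> = (real n - real N) / real n"
    using assms by (simp add: abs_if field_simps)
  also have "(real n - real N) / real n * 1 + (1 / real n) * real (card {N<..n}) = 2 * (real n - real N) / real n"
    using assms by (simp add: of_nat_diff)
  finally show ?thesis
    by (simp add: dist_norm)
qed

text \<open>All terms after time \<open>N\<close> equal the same vertex, so resting in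
  \<open>i\<close> moves the vector along the segment towards \<open>axis i 1\<close>.\<close>

lemma empirical_stay:
  assumes "N \<le> n" "0 < N" "\<And>k. k \<in> {N<..n} \<Longrightarrow> s k = i"
  shows "empirical s n = (real N / real n) *\<^sub>R empirical s N + (1 - real N / real n) *\<^sub>R axis i 1"
proof -
  have "(\<Sum>k\<in>{N<..n}. axis (s k) (1 :: real)) = (\<Sum>k\<in>{N<..n}. axis i 1)"
    using assms(3) by (intro sum.cong) auto
  also have "\<dots> = (real n - real N) *\<^sub>R axis i 1"
    using assms(1) by (simp add: sum_constant_scaleR of_nat_diff del: sum_constant)
  finally show ?thesis
    using assms by (subst empirical_split[OF assms(1,2)]) (simp add: diff_divide_distrib)
qed

section \<open>Elementary estimates\<close>

text \<open>Counting from the least admissible number, all others exceed it by at most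
  \<open>2 * a\<close>; the centre \<open>t\<close> need not be an integer.\<close>

lemma card_near:
  fixes t :: real and a :: nat
  defines "W \<equiv> {v :: nat. \<bar>real v - t\<bar> \<le> real a}"
  shows "finite W" "card W \<le> 2 * a + 1"
proof -
  have "finite W \<and> card W \<le> 2 * a + 1"
  proof (cases "W = {}")
    case False
    define m where "m = (LEAST v. v \<in> W)"
    have "m \<in> W"
      using False unfolding m_def by (metis LeastI ex_in_conv)
    have "W \<subseteq> {m..m + 2 * a}"
    proof
      fix v assume v: "v \<in> W"
      then have "m \<le> v"
        unfolding m_def by (rule Least_le)
      moreover have "real v \<le> real m + 2 * real a"
        using v \<open>m \<in> W\<close> by (auto simp: W_def abs_le_iff)
      then have "v \<le> m + 2 * a" by linarith
      ultimately show "v \<in> {m..m + 2 * a}" by simp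
    qed
    then show ?thesis
      using card_mono[of "{m..m + 2 * a}" W] finite_subset by auto
  qed auto
  then show "finite W" "card W \<le> 2 * a + 1" by auto
qed

lemma prob_simplex_subset_hull: "(prob_simplex :: (real ^ 'm) set) \<subseteq> convex hull (range (\<lambda>i. axis i 1))"
proof
  fix x :: "real ^ 'm" assume x: "x \<in> prob_simplex"
  have "x = (\<Sum>i\<in>UNIV. x $ i *\<^sub>R axis i 1)"
    using basis_expansion[of x] by (simp add: scalar_mult_eq_scaleR)
  also have "\<dots> \<in> convex hull (range (\<lambda>i. axis i 1))"
    using x by (intro convex_sum) (auto simp: prob_simplex_def convex_convex_hull hull_inc)
  finally show "x \<in> convex hull (range (\<lambda>i. axis i 1))" .
qed

text \<open>From \<open>ln (1 - x) \<ge> - x - 2 * x\<^sup>2\<close> and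
  \<open>x\<^sup>2 \<le> x / 2\<close>. It turns products of survival probabilities into
  exponentials.\<close>

lemma exp_minus_double_le:
  fixes x :: real
  assumes "0 \<le> x" "x \<le> 1 / 2"
  shows "exp (- 2 * x) \<le> 1 - x"
proof -
  have "x * x \<le> x * (1 / 2)"
    using assms by (intro mult_left_mono) auto
  then have "- 2 * x \<le> ln (1 - x)"
    using ln_one_minus_pos_lower_bound[OF assms] by (simp add: power2_eq_square)
  then show ?thesis
    using assms by (subst ln_ge_iff[symmetric]) auto
qed

lemma floor_fraction:
  assumes "0 < \<theta>" "\<theta> \<le> 1"
  shows "real (nat \<lfloor>\<theta> * real n\<rfloor>) \<le> \<theta> * real n"
    and "\<theta> * real n - 1 < real (nat \<lfloor>\<theta> * real n\<rfloor>)"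
    and "nat \<lfloor>\<theta> * real n\<rfloor> \<le> n"
    and "filterlim (\<lambda>n. nat \<lfloor>\<theta> * real n\<rfloor>) sequentially sequentially"
proof -
  have "0 \<le> \<theta> * real n" using assms by simp
  then show 1: "real (nat \<lfloor>\<theta> * real n\<rfloor>) \<le> \<theta> * real n"
    and "\<theta> * real n - 1 < real (nat \<lfloor>\<theta> * real n\<rfloor>)"
    by linarith+
  have "\<theta> * real n \<le> 1 * real n" using assms by (intro mult_right_mono) auto
  with 1 show "nat \<lfloor>\<theta> * real n\<rfloor> \<le> n" by linarith
  have "filterlim (\<lambda>n. \<theta> * real n) at_top sequentially"
    using assms(1) by (intro filterlim_tendsto_pos_mult_at_top[OF tendsto_const]
        filterlim_real_sequentially)
  then show "filterlim (\<lambda>n. nat \<lfloor>\<theta> * real n\<rfloor>) sequentially sequentially"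
    by (intro filterlim_compose[OF filterlim_nat_sequentially]
        filterlim_compose[OF filterlim_floor_sequentially])
qed

section \<open>Probabilities of path events and the Markov property\<close>

locale generator_chain =
  fixes G :: "real ^ 'm ^ 'm" and M :: "'w measure" and X :: "nat \<Rightarrow> 'w \<Rightarrow> 'm"
    and \<pi> :: "'m pmf"
  assumes card_ge_2: "CARD('m) \<ge> 2"
    and generator: "G \<in> generators"
    and chain: "markov_chain M X \<pi> (trans_matrix G)"
begin

sublocale prob_space M
  using chain by (simp add: markov_chain_def)

lemma X_measurable [measurable]: "X n \<in> measurable M (count_space UNIV)"
  using chain by (simp add: markov_chain_def)

text \<open>The law of the path, evaluated on predicates. By the convention of
  \<open>measure\<close> the value is 0 when the set is not an event.\<close>

definition pr :: "((nat \<Rightarrow> 'm) \<Rightarrow> bool) \<Rightarrow> real" where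
  "pr R = prob {\<omega> \<in> space M. R (\<lambda>k. X k \<omega>)}"

definition path :: "nat \<Rightarrow> (nat \<Rightarrow> 'm) \<Rightarrow> (nat \<Rightarrow> 'm) \<Rightarrow> bool" where
  "path n t s \<longleftrightarrow> (\<forall>k\<le>n. s k = t k)"

lemma path_event: "{\<omega> \<in> space M. path n t (\<lambda>k. X k \<omega>)} \<in> events"
  unfolding path_def by measurable

text \<open>An event of the past is a finite union of cylinders, indexed by extensional prefixes so
  that each prefix occurs once. The extra condition \<open>Q\<close> is carried along for events
  that also look beyond time \<open>n\<close>.\<close>

lemma hist_decompose:
  assumes "hist n R"
  shows "{\<omega> \<in> space M. R (\<lambda>k. X k \<omega>) \<and> Q \<omega>} =
    (\<Union>t\<in>{t \<in> PiE {..n} (\<lambda>_. UNIV). R t}. {\<omega> \<in> space M. path n t (\<lambda>k. X k \<omega>) \<and> Q \<omega>})"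
proof (intro equalityI subsetI)
  fix \<omega> assume \<omega>: "\<omega> \<in> {\<omega> \<in> space M. R (\<lambda>k. X k \<omega>) \<and> Q \<omega>}"
  let ?t = "restrict (\<lambda>k. X k \<omega>) {..n}"
  have "R ?t = R (\<lambda>k. X k \<omega>)"
    by (rule histD[OF assms]) auto
  with \<omega> show "\<omega> \<in> (\<Union>t\<in>{t \<in> PiE {..n} (\<lambda>_. UNIV). R t}.
      {\<omega> \<in> space M. path n t (\<lambda>k. X k \<omega>) \<and> Q \<omega>})"
    by (intro UN_I[of ?t]) (auto simp: path_def)
next
  fix \<omega> assume "\<omega> \<in> (\<Union>t\<in>{t \<in> PiE {..n} (\<lambda>_. UNIV). R t}.
      {\<omega> \<in> space M. path n t (\<lambda>k. X k \<omega>) \<and> Q \<omega>})"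
  then obtain t where "R t" "path n t (\<lambda>k. X k \<omega>)" "Q \<omega>" "\<omega> \<in> space M" by auto
  moreover have "R (\<lambda>k. X k \<omega>) = R t"
    by (rule histD[OF assms]) (use calculation in \<open>auto simp: path_def\<close>)
  ultimately show "\<omega> \<in> {\<omega> \<in> space M. R (\<lambda>k. X k \<omega>) \<and> Q \<omega>}" by auto
qed

lemma hist_event [intro]:
  assumes "hist n R"
  shows "{\<omega> \<in> space M. R (\<lambda>k. X k \<omega>)} \<in> events"
proof -
  have "{\<omega> \<in> space M. R (\<lambda>k. X k \<omega>)} =
    (\<Union>t\<in>{t \<in> PiE {..n} (\<lambda>_. UNIV). R t}. {\<omega> \<in> space M. path n t (\<lambda>k. X k \<omega>)})"
    using hist_decompose[OF assms, of "\<lambda>_. True"] by simp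
  also have "\<dots> \<in> events"
    by (intro sets.finite_UN finite_subset[OF _ finite_PiE[of "{..n}" "\<lambda>_. UNIV"]] path_event) auto
  finally show ?thesis .
qed

lemma pr_decompose:
  assumes "hist n R" "hist m Q"
  shows "pr (\<lambda>s. R s \<and> Q s) =
    (\<Sum>t\<in>{t \<in> PiE {..n} (\<lambda>_. UNIV). R t}. pr (\<lambda>s. path n t s \<and> Q s))"
proof -
  let ?T = "{t \<in> PiE {..n} (\<lambda>_. UNIV). R t} :: (nat \<Rightarrow> 'm) set"
  let ?A = "\<lambda>t. {\<omega> \<in> space M. path n t (\<lambda>k. X k \<omega>) \<and> Q (\<lambda>k. X k \<omega>)}"
  have fin: "finite ?T"
    by (intro finite_subset[OF _ finite_PiE[of "{..n}" "\<lambda>_. UNIV"]]) auto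
  have ev: "?A t \<in> events" for t
    using sets.Int[OF path_event hist_event[OF assms(2)], of n t]
    by (auto simp: Int_def conj_commute conj_left_commute cong: conj_cong)
  have dis: "disjoint_family_on ?A ?T"
    unfolding disjoint_family_on_def
  proof (intro ballI impI)
    fix t u assume "t \<in> ?T" "u \<in> ?T" "t \<noteq> u"
    moreover have "t = u" if "\<omega> \<in> ?A t" "\<omega> \<in> ?A u" for \<omega>
    proof
      fix k show "t k = u k"
        using that \<open>t \<in> ?T\<close> \<open>u \<in> ?T\<close>
        by (cases "k \<le> n") (auto simp: path_def PiE_def extensional_def)
    qed
    ultimately show "?A t \<inter> ?A u = {}" by auto
  qed
  show ?thesis
    unfolding pr_def hist_decompose[OF assms(1)]
    using finite_measure_finite_Union[OF fin _ dis] ev by auto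
qed

text \<open>The defining condition of the chain speaks only of complete histories of positive
  probability. Summing over histories extends it to any event of the past; in product form null
  histories contribute 0 on both sides.\<close>

lemma markov_step:
  assumes "hist n R"
  shows "pr (\<lambda>s. R s \<and> s n = i \<and> s (Suc n) = j) =
    pr (\<lambda>s. R s \<and> s n = i) * trans_matrix G (Suc n) $ i $ j"
proof -
  let ?T = "{t \<in> PiE {..n} (\<lambda>_. UNIV). R t \<and> t n = i} :: (nat \<Rightarrow> 'm) set"
  have h: "hist n (\<lambda>s. R s \<and> s n = i)"
    using assms unfolding hist_def by (metis le_refl)
  have step: "pr (\<lambda>s. path n t s \<and> s (Suc n) = j) =
      pr (path n t) * trans_matrix G (Suc n) $ i $ j" if t: "t \<in> ?T" for t
  proof (cases "pr (path n t) > 0")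
    case True
    \<comment> \<open>The chain condition reads history and next state off one path, so the target
      \<open>j\<close> is written into \<open>t\<close> at \<open>Suc n\<close>.\<close>
    define u where "u = t(Suc n := j)"
    have u: "(\<forall>k\<le>n. s k = u k) \<longleftrightarrow> path n t s" for s :: "nat \<Rightarrow> 'm"
      by (auto simp: u_def path_def)
    have "\<P>(\<omega> in M. \<forall>k\<le>n. X k \<omega> = u k) > 0"
      using True by (simp add: u pr_def)
    then have "\<P>(\<omega> in M. X (Suc n) \<omega> = u (Suc n) \<bar> \<forall>k\<le>n. X k \<omega> = u k) =
        trans_matrix G (Suc n) $ u n $ u (Suc n)"
      using chain unfolding markov_chain_def by blast
    then have "\<P>(\<omega> in M. X (Suc n) \<omega> = j \<bar> path n t (\<lambda>k. X k \<omega>)) =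
        trans_matrix G (Suc n) $ i $ j"
      using t by (simp add: u) (simp add: u_def)
    then show ?thesis
      using True unfolding cond_prob_def pr_def
      by (simp add: field_simps conj_commute)
  next
    case False
    then have "pr (path n t) = 0"
      by (simp add: pr_def zero_less_measure_iff)
    moreover have "pr (\<lambda>s. path n t s \<and> s (Suc n) = j) \<le> pr (path n t)"
      unfolding pr_def by (intro finite_measure_mono path_event) auto
    ultimately show ?thesis
      by (simp add: pr_def measure_le_0_iff)
  qed
  have "pr (\<lambda>s. (R s \<and> s n = i) \<and> s (Suc n) = j) =
      (\<Sum>t\<in>?T. pr (\<lambda>s. path n t s \<and> s (Suc n) = j))"
    by (rule pr_decompose[OF h]) (rule hist_coord[OF order.refl])
  also have "\<dots> = (\<Sum>t\<in>?T. pr (path n t)) * trans_matrix G (Suc n) $ i $ j"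
    by (simp add: step sum_distrib_right)
  also have "(\<Sum>t\<in>?T. pr (path n t)) = pr (\<lambda>s. R s \<and> s n = i)"
    using pr_decompose[OF h hist_const[of 0 True]] by simp
  finally show ?thesis by simp
qed

lemma pr_nonneg: "0 \<le> pr R"
  by (simp add: pr_def)

lemma pr_le_1: "pr R \<le> 1"
  by (simp add: pr_def)

lemma pr_True: "pr (\<lambda>s. True) = 1"
  using prob_space by (simp add: pr_def)

lemma pr_mono:
  assumes "\<And>s. R s \<Longrightarrow> Q s" "hist n Q"
  shows "pr R \<le> pr Q"
  unfolding pr_def using assms by (intro finite_measure_mono) auto

lemma pr_split:
  assumes "hist n R" "hist m Q"
  shows "pr R = pr (\<lambda>s. R s \<and> Q s) + pr (\<lambda>s. R s \<and> \<not> Q s)"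
proof -
  have "prob ({\<omega> \<in> space M. R (\<lambda>k. X k \<omega>)}) =
     prob ({\<omega> \<in> space M. R (\<lambda>k. X k \<omega>)} \<inter> {\<omega> \<in> space M. Q (\<lambda>k. X k \<omega>)}) +
     prob ({\<omega> \<in> space M. R (\<lambda>k. X k \<omega>)} - {\<omega> \<in> space M. Q (\<lambda>k. X k \<omega>)})"
    by (subst finite_measure_Union[symmetric])
      (auto intro!: arg_cong[where f=prob] hist_event[OF assms(1)] hist_event[OF assms(2)])
  also have "{\<omega> \<in> space M. R (\<lambda>k. X k \<omega>)} \<inter> {\<omega> \<in> space M. Q (\<lambda>k. X k \<omega>)} =
      {\<omega> \<in> space M. R (\<lambda>k. X k \<omega>) \<and> Q (\<lambda>k. X k \<omega>)}" by auto
  also have "{\<omega> \<in> space M. R (\<lambda>k. X k \<omega>)} - {\<omega> \<in> space M. Q (\<lambda>k. X k \<omega>)} =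
      {\<omega> \<in> space M. R (\<lambda>k. X k \<omega>) \<and> \<not> Q (\<lambda>k. X k \<omega>)}" by auto
  finally show ?thesis by (simp add: pr_def)
qed

lemma pr_sum_states:
  assumes "hist n R" "k \<le> n"
  shows "pr (\<lambda>s. R s \<and> s k \<in> A) = (\<Sum>i\<in>A. pr (\<lambda>s. R s \<and> s k = i))"
proof -
  have h: "hist n (\<lambda>s. R s \<and> s k = i)" for i
    using assms unfolding hist_def by metis
  have "prob (\<Union>i\<in>A. {\<omega> \<in> space M. R (\<lambda>k. X k \<omega>) \<and> X k \<omega> = i}) =
      (\<Sum>i\<in>A. prob {\<omega> \<in> space M. R (\<lambda>k. X k \<omega>) \<and> X k \<omega> = i})"
    by (rule finite_measure_finite_Union)
      (auto simp: disjoint_family_on_def intro!: hist_event[OF h])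
  also have "(\<Union>i\<in>A. {\<omega> \<in> space M. R (\<lambda>k. X k \<omega>) \<and> X k \<omega> = i}) =
     {\<omega> \<in> space M. R (\<lambda>k. X k \<omega>) \<and> X k \<omega> \<in> A}" by auto
  finally show ?thesis by (simp add: pr_def)
qed

section \<open>Bounds for leaving and entering a state\<close>

definition max_rate :: real where
  "max_rate = (MAX i. - G $ i $ i)"

text \<open>The minimum is over a nonempty set since there are at least two states. It bounds from
  below both the rate of leaving a state and the rate of entering it from any other state.\<close>

definition min_rate :: real where
  "min_rate = Min ((\<lambda>(i, j). G $ i $ j) ` {(i, j). i \<noteq> j})"

lemma offdiag_pos: "i \<noteq> j \<Longrightarrow> 0 < G $ i $ j"
  using generator by (auto simp: generators_def)

lemma diag_eq: "- G $ i $ i = (\<Sum>j\<in>-{i}. G $ i $ j)"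
  using generator by (auto simp: generators_def Compl_eq_Diff_UNIV)

lemma diag_le_max_rate: "- G $ i $ i \<le> max_rate"
  unfolding max_rate_def by (intro Max_ge) auto

lemma offdiag_le_diag: "i \<noteq> j \<Longrightarrow> G $ i $ j \<le> - G $ i $ i"
  unfolding diag_eq by (intro member_le_sum) (auto intro: less_imp_le offdiag_pos)

lemma obtain_other:
  obtains j where "i \<noteq> (j :: 'm)"
proof -
  have "\<not> UNIV \<subseteq> {i}"
    using card_ge_2 card_mono[of "{i}" "UNIV :: 'm set"] by auto
  then obtain j where "j \<notin> {i}" by blast
  then show ?thesis using that[of j] by auto
qed

lemma min_rate_le: "i \<noteq> j \<Longrightarrow> min_rate \<le> G $ i $ j"
  unfolding min_rate_def by (intro Min_le) auto

lemma min_rate_le_diag: "min_rate \<le> - G $ i $ i"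
  using obtain_other[of i] min_rate_le offdiag_le_diag order_trans by metis

lemma min_rate_pos: "0 < min_rate"
proof -
  obtain i j :: 'm where "i \<noteq> j"
    using obtain_other[of undefined] by metis
  then show ?thesis
    unfolding min_rate_def by (subst Min_gr_iff) (auto intro!: offdiag_pos)
qed

lemma max_rate_pos: "0 < max_rate"
  using min_rate_pos min_rate_le_diag diag_le_max_rate by (meson less_le_trans)

lemma trans_matrix_offdiag:
  "i \<noteq> j \<Longrightarrow> trans_matrix G n $ i $ j = (if n \<le> start_index G then 0 else G $ i $ j / real n)"
  by (simp add: trans_matrix_def mat_def)

text \<open>Sum \<open>markov_step\<close> over all targets other than \<open>i\<close>; the
  vanishing row sums of \<open>G\<close> turn the sum of rates into the diagonal entry.\<close>

lemma leave_eq: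
  assumes "hist n R"
  shows "pr (\<lambda>s. R s \<and> s n = i \<and> s (Suc n) \<noteq> i) = pr (\<lambda>s. R s \<and> s n = i) *
    (if Suc n \<le> start_index G then 0 else - G $ i $ i / real (Suc n))"
proof -
  have h: "hist (Suc n) (\<lambda>s. R s \<and> s n = i)"
    using hist_mono[OF assms, of "Suc n"] unfolding hist_def by (metis le_SucI le_refl)
  have "pr (\<lambda>s. R s \<and> s n = i \<and> s (Suc n) \<noteq> i) = pr (\<lambda>s. (R s \<and> s n = i) \<and> s (Suc n) \<in> -{i})"
    by simp
  also have "\<dots> = (\<Sum>j\<in>-{i}. pr (\<lambda>s. R s \<and> s n = i \<and> s (Suc n) = j))"
    by (subst pr_sum_states[OF h]) simp_all
  also have "\<dots> = pr (\<lambda>s. R s \<and> s n = i) * (\<Sum>j\<in>-{i}. trans_matrix G (Suc n) $ i $ j)"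
    by (simp only: markov_step[OF assms] sum_distrib_left)
  also have "(\<Sum>j\<in>-{i}. trans_matrix G (Suc n) $ i $ j) =
      (\<Sum>j\<in>-{i}. if Suc n \<le> start_index G then 0 else G $ i $ j / real (Suc n))"
    by (intro sum.cong refl trans_matrix_offdiag) auto
  also have "\<dots> = (if Suc n \<le> start_index G then 0 else - G $ i $ i / real (Suc n))"
    unfolding diag_eq by (simp add: sum_divide_distrib)
  finally show ?thesis .
qed

lemma leave_le:
  assumes "hist n R"
  shows "pr (\<lambda>s. R s \<and> s n = i \<and> s (Suc n) \<noteq> i) \<le> max_rate / Suc n * pr (\<lambda>s. R s \<and> s n = i)"
proof -
  have "(if Suc n \<le> start_index G then 0 else - G $ i $ i / real (Suc n)) \<le> max_rate / Suc n"
    using max_rate_pos divide_right_mono[OF diag_le_max_rate[of i], of "real (Suc n)"] by simp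
  then show ?thesis
    unfolding leave_eq[OF assms] by (subst mult.commute) (rule mult_right_mono[OF _ pr_nonneg])
qed

text \<open>The step out of time \<open>n\<close> uses the matrix of index \<open>Suc n\<close>,
  which is past the initial identity matrices as soon as
  \<open>start_index G \<le> n\<close>.\<close>

lemma leave_ge:
  assumes "hist n R" "start_index G \<le> n"
  shows "min_rate / Suc n * pr (\<lambda>s. R s \<and> s n = i) \<le> pr (\<lambda>s. R s \<and> s n = i \<and> s (Suc n) \<noteq> i)"
proof -
  have "min_rate / Suc n \<le> (if Suc n \<le> start_index G then 0 else - G $ i $ i / real (Suc n))"
    using assms(2) divide_right_mono[OF min_rate_le_diag[of i], of "real (Suc n)"] by simp
  then show ?thesis
    unfolding leave_eq[OF assms(1)] by (subst (2) mult.commute) (rule mult_right_mono[OF _ pr_nonneg])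
qed

lemma enter_eq:
  assumes "hist n R"
  shows "pr (\<lambda>s. R s \<and> s n \<noteq> i \<and> s (Suc n) = i) =
    (\<Sum>j\<in>-{i}. pr (\<lambda>s. R s \<and> s n = j) * trans_matrix G (Suc n) $ j $ i)"
proof -
  have h: "hist (Suc n) (\<lambda>s. R s \<and> s (Suc n) = i)"
    using hist_mono[OF assms, of "Suc n"] unfolding hist_def by (metis le_SucI le_refl)
  have "pr (\<lambda>s. R s \<and> s n \<noteq> i \<and> s (Suc n) = i) = pr (\<lambda>s. (R s \<and> s (Suc n) = i) \<and> s n \<in> -{i})"
    by (rule arg_cong[where f=pr]) auto
  also have "\<dots> = (\<Sum>j\<in>-{i}. pr (\<lambda>s. R s \<and> s n = j \<and> s (Suc n) = i))"
    by (subst pr_sum_states[OF h]) (simp_all add: conj_commute conj_left_commute)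
  finally show ?thesis
    by (simp only: markov_step[OF assms])
qed

lemma pr_not_state:
  assumes "hist n R"
  shows "pr (\<lambda>s. R s \<and> s n \<noteq> i) = (\<Sum>j\<in>-{i}. pr (\<lambda>s. R s \<and> s n = j))"
  using pr_sum_states[OF assms order.refl, of "-{i}"] by simp

text \<open>A single rate \<open>G $ j $ i\<close> is at most the total exit rate of
  \<open>j\<close>, hence at most \<open>max_rate\<close>; this is applied to each source state
  separately.\<close>

lemma enter_le:
  assumes "hist n R"
  shows "pr (\<lambda>s. R s \<and> s n \<noteq> i \<and> s (Suc n) = i) \<le> max_rate / Suc n * pr (\<lambda>s. R s \<and> s n \<noteq> i)"
  unfolding enter_eq[OF assms] pr_not_state[OF assms] sum_distrib_left
proof (rule sum_mono)
  fix j assume "j \<in> -{i}"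
  then have "G $ j $ i \<le> max_rate"
    using offdiag_le_diag[of j i] diag_le_max_rate[of j] by auto
  then have "trans_matrix G (Suc n) $ j $ i \<le> max_rate / Suc n"
    using \<open>j \<in> -{i}\<close> max_rate_pos trans_matrix_offdiag[of j i "Suc n"]
    by (auto simp: divide_right_mono)
  then show "pr (\<lambda>s. R s \<and> s n = j) * trans_matrix G (Suc n) $ j $ i
      \<le> max_rate / Suc n * pr (\<lambda>s. R s \<and> s n = j)"
    by (subst mult.commute) (rule mult_right_mono[OF _ pr_nonneg])
qed

lemma enter_ge:
  assumes "hist n R" "start_index G \<le> n"
  shows "min_rate / Suc n * pr (\<lambda>s. R s \<and> s n \<noteq> i) \<le> pr (\<lambda>s. R s \<and> s n \<noteq> i \<and> s (Suc n) = i)"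
  unfolding enter_eq[OF assms(1)] pr_not_state[OF assms(1)] sum_distrib_left
proof (rule sum_mono)
  fix j assume "j \<in> -{i}"
  then have "min_rate / Suc n \<le> trans_matrix G (Suc n) $ j $ i"
    using assms(2) divide_right_mono[OF min_rate_le[of j i], of "real (Suc n)"]
    by (simp add: trans_matrix_offdiag)
  then show "min_rate / Suc n * pr (\<lambda>s. R s \<and> s n = j)
      \<le> pr (\<lambda>s. R s \<and> s n = j) * trans_matrix G (Suc n) $ j $ i"
    by (subst (2) mult.commute) (rule mult_right_mono[OF _ pr_nonneg])
qed

lemma change_split:
  assumes "hist n R"
  shows "pr R = pr (\<lambda>s. R s \<and> (s n = i \<longleftrightarrow> s (Suc n) = i)) +
    pr (\<lambda>s. R s \<and> s n = i \<and> s (Suc n) \<noteq> i) + pr (\<lambda>s. R s \<and> s n \<noteq> i \<and> s (Suc n) = i)"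
proof -
  let ?Q = "\<lambda>s. s n = i \<longleftrightarrow> s (Suc n) = i"
  have hQ: "hist (Suc n) ?Q"
    by (simp add: hist_def)
  have h: "hist (Suc n) (\<lambda>s. R s \<and> \<not> ?Q s)"
    by (intro hist_conj hist_not hQ hist_mono[OF assms]) auto
  have "pr R = pr (\<lambda>s. R s \<and> ?Q s) + pr (\<lambda>s. R s \<and> \<not> ?Q s)"
    by (rule pr_split[OF assms hQ])
  also have "pr (\<lambda>s. R s \<and> \<not> ?Q s) =
      pr (\<lambda>s. (R s \<and> \<not> ?Q s) \<and> s n = i) + pr (\<lambda>s. (R s \<and> \<not> ?Q s) \<and> s n \<noteq> i)"
    by (rule pr_split[OF h hist_coord[OF order.refl]])
  also have "(\<lambda>s. (R s \<and> \<not> ?Q s) \<and> s n = i) = (\<lambda>s. R s \<and> s n = i \<and> s (Suc n) \<noteq> i)"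
    by auto
  also have "(\<lambda>s. (R s \<and> \<not> ?Q s) \<and> s n \<noteq> i) = (\<lambda>s. R s \<and> s n \<noteq> i \<and> s (Suc n) = i)"
    by auto
  finally show ?thesis by simp
qed

section \<open>Anticoncentration of visit counts\<close>

text \<open>Only the division into \<open>i\<close> and its complement is frozen; jumps among the
  other states remain allowed.\<close>

definition no_change :: "'m \<Rightarrow> nat \<Rightarrow> nat \<Rightarrow> (nat \<Rightarrow> 'm) \<Rightarrow> bool" where
  "no_change i a n s \<longleftrightarrow> (\<forall>k\<in>{a..<n}. s k = i \<longleftrightarrow> s (Suc k) = i)"

lemma hist_no_change: "hist n (no_change i a n)"
  unfolding hist_def no_change_def by auto

text \<open>On either side of \<open>i\<close>, a change at the step out of time \<open>k\<close>
  has conditional probability at least \<open>min_rate / Suc k\<close>. The product of the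
  complementary factors is bounded by a telescoping product of powers.\<close>

lemma pr_no_change_le:
  assumes "start_index G \<le> a" "a \<le> n"
  shows "pr (no_change i a n) \<le> (real (Suc a) / real (Suc n)) powr min_rate"
  using assms(2)
proof (induction n rule: dec_induct)
  case base
  then show ?case by (simp add: pr_le_1)
next
  case (step n)
  let ?E = "no_change i a n"
  define x where "x = min_rate / Suc n"
  have "pr ?E = pr (\<lambda>s. ?E s \<and> s n = i) + pr (\<lambda>s. ?E s \<and> s n \<noteq> i)"
    by (rule pr_split[OF hist_no_change hist_coord[OF order.refl]])
  moreover have "x * pr (\<lambda>s. ?E s \<and> s n = i) \<le> pr (\<lambda>s. ?E s \<and> s n = i \<and> s (Suc n) \<noteq> i)"
    "x * pr (\<lambda>s. ?E s \<and> s n \<noteq> i) \<le> pr (\<lambda>s. ?E s \<and> s n \<noteq> i \<and> s (Suc n) = i)"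
    unfolding x_def using assms(1) step.hyps(1)
    by (rule_tac leave_ge[OF hist_no_change] enter_ge[OF hist_no_change]; linarith)+
  ultimately have "x * pr ?E \<le> pr (\<lambda>s. ?E s \<and> s n = i \<and> s (Suc n) \<noteq> i) +
      pr (\<lambda>s. ?E s \<and> s n \<noteq> i \<and> s (Suc n) = i)"
    by (simp add: distrib_left)
  moreover have "no_change i a (Suc n) = (\<lambda>s. ?E s \<and> (s n = i \<longleftrightarrow> s (Suc n) = i))"
    using step.hyps(1) by (auto simp: fun_eq_iff no_change_def atLeastLessThanSuc)
  ultimately have "pr (no_change i a (Suc n)) \<le> (1 - x) * pr ?E"
    using change_split[OF hist_no_change[of n i a], of i] by (simp add: algebra_simps)
  also have "\<dots> \<le> exp (- x) * pr ?E"
    using exp_ge_add_one_self[of "-x"] by (intro mult_right_mono pr_nonneg) auto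
  also have "\<dots> \<le> (real (Suc n) / real (Suc (Suc n))) powr min_rate *
      (real (Suc a) / real (Suc n)) powr min_rate"
  proof (rule mult_mono[OF _ step.IH])
    \<comment> \<open>The estimate \<open>ln (1 + y) \<le> y\<close> replaces the exponential factor
      by a power of a ratio of consecutive numbers, which then cancels against the induction
      hypothesis.\<close>
    have "ln (real (Suc (Suc n)) / real (Suc n)) = ln (1 + 1 / real (Suc n))"
      by (simp add: field_simps)
    also have "\<dots> \<le> 1 / real (Suc n)"
      by (rule ln_add_one_self_le_self) simp
    finally have "- (1 / real (Suc n)) \<le> ln (real (Suc n) / real (Suc (Suc n)))"
      by (simp add: ln_div)
    from mult_left_mono[OF this less_imp_le[OF min_rate_pos]]
    show "exp (- x) \<le> (real (Suc n) / real (Suc (Suc n))) powr min_rate"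
      by (simp add: powr_def x_def)
  qed (auto simp: pr_nonneg)
  also have "\<dots> = (real (Suc a) / real (Suc (Suc n))) powr min_rate"
    by (subst powr_mult[symmetric]) simp_all
  finally show ?case .
qed

lemma hist_visits: "k \<le> n \<Longrightarrow> hist n (\<lambda>s. Q (visits A s k))"
  unfolding hist_def using visits_cong by (metis order.trans)

text \<open>The sum is the expected number of indices whose event occurs, and on each path this
  number is at most \<open>c\<close>.\<close>

lemma sum_pr_le:
  assumes "finite K" "\<And>k. k \<in> K \<Longrightarrow> hist n (R k)" "\<And>s. real (card {k \<in> K. R k s}) \<le> c"
  shows "(\<Sum>k\<in>K. pr (R k)) \<le> c"
proof -
  let ?A = "\<lambda>k. {\<omega> \<in> space M. R k (\<lambda>k. X k \<omega>)}"
  have ev: "?A k \<in> events" if "k \<in> K" for k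
    using assms(2)[OF that] by (rule hist_event)
  have "(\<Sum>k\<in>K. pr (R k)) = (\<Sum>k\<in>K. \<integral>\<omega>. indicator (?A k) \<omega> \<partial>M)"
    using ev by (intro sum.cong refl) (simp add: pr_def)
  also have "\<dots> = (\<integral>\<omega>. (\<Sum>k\<in>K. indicator (?A k) \<omega>) \<partial>M)"
    using ev by (subst Bochner_Integration.integral_sum) (auto simp: integrable_indicator_iff less_top[symmetric])
  also have "\<dots> \<le> (\<integral>\<omega>. c \<partial>M)"
  proof (rule integral_mono)
    fix \<omega> assume "\<omega> \<in> space M"
    then have "(\<Sum>k\<in>K. indicator (?A k) \<omega>) = real (card {k \<in> K. R k (\<lambda>k. X k \<omega>)})"
      using assms(1) by (simp add: indicator_def sum.If_cases Int_def)
    with assms(3) show "(\<Sum>k\<in>K. indicator (?A k) \<omega>) \<le> c" by simp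
  qed (use ev in \<open>auto simp: integrable_indicator_iff less_top[symmetric]\<close>)
  also have "\<dots> = c" using prob_space by simp
  finally show ?thesis .
qed

lemma pr_union_le:
  assumes "finite K" "\<And>k. k \<in> K \<Longrightarrow> hist n (R k)" "hist n Q"
    and "\<And>s. S s \<Longrightarrow> Q s \<or> (\<exists>k\<in>K. R k s)"
  shows "pr S \<le> pr Q + (\<Sum>k\<in>K. pr (R k))"
proof -
  let ?A = "\<lambda>k. {\<omega> \<in> space M. R k (\<lambda>k. X k \<omega>)}" and ?Q = "{\<omega> \<in> space M. Q (\<lambda>k. X k \<omega>)}"
  have ev: "?A k \<in> events" if "k \<in> K" for k
    using assms(2)[OF that] by (rule hist_event)
  have evQ: "?Q \<in> events"
    using assms(3) by (rule hist_event)
  have evU: "(\<Union>k\<in>K. ?A k) \<in> events"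
    using assms(1) ev by auto
  have "pr S \<le> prob (?Q \<union> (\<Union>k\<in>K. ?A k))"
    unfolding pr_def using assms(4) evQ evU by (intro finite_measure_mono) (auto dest!: assms(4))
  also have "\<dots> \<le> prob ?Q + prob (\<Union>k\<in>K. ?A k)"
    using evQ evU by (rule measure_Un_le)
  also have "prob (\<Union>k\<in>K. ?A k) \<le> (\<Sum>k\<in>K. prob (?A k))"
    using assms(1) ev by (intro finite_measure_subadditive_finite) auto
  finally show ?thesis by (simp add: pr_def)
qed

lemma no_change_const:
  assumes "no_change i k n s" "l \<in> {k..n}"
  shows "s l = i \<longleftrightarrow> s k = i"
proof -
  have "k \<le> l" "l \<le> n" using assms(2) by auto
  then show ?thesis
  proof (induction l rule: dec_induct)
    case (step l)
    then show ?case using assms(1) by (auto simp: no_change_def)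
  qed simp
qed

text \<open>After the latest change of side before \<open>n\<close> the path stays on one side, so
  the count of the side it has just left is frozen.\<close>

lemma last_change:
  assumes "\<not> no_change i a n s"
  obtains k where "k \<in> {a..<n}"
    "s k = i \<and> s (Suc k) \<noteq> i \<and> visits {i} s k = visits {i} s n \<or>
     s k \<noteq> i \<and> s (Suc k) = i \<and> visits (-{i}) s k = visits (-{i}) s n"
proof -
  let ?K = "{k \<in> {a..<n}. (s k = i) \<noteq> (s (Suc k) = i)}"
  define k where "k = Max ?K"
  have k: "k \<in> ?K"
    unfolding k_def using assms by (intro Max_in) (auto simp: no_change_def)
  have k_last: "j \<notin> ?K" if "k < j" for j
  proof
    assume "j \<in> ?K"
    then have "j \<le> k" unfolding k_def by (intro Max_ge) auto
    with that show False by simp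
  qed
  have nc: "no_change i (Suc k) n s"
    unfolding no_change_def
  proof (intro ballI)
    fix j assume "j \<in> {Suc k..<n}"
    then have "j \<in> {a..<n}" "j \<notin> ?K" using k k_last[of j] by auto
    then show "(s j = i) = (s (Suc j) = i)" by blast
  qed
  have const: "s l = i \<longleftrightarrow> s (Suc k) = i" if "l \<in> {k<..n}" for l
    using that by (intro no_change_const[OF nc]) auto
  show ?thesis
  proof (cases "s k = i")
    case True
    with k have "s (Suc k) \<noteq> i" by auto
    then have "visits {i} s n = visits {i} s k"
      using k const by (intro visits_no_visit) auto
    with True \<open>s (Suc k) \<noteq> i\<close> k show ?thesis by (intro that[of k]) simp_all
  next
    case False
    with k have "s (Suc k) = i" by auto
    then have "visits (-{i}) s n = visits (-{i}) s k"
      using k const by (intro visits_no_visit) auto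
    with False \<open>s (Suc k) = i\<close> k show ?thesis by (intro that[of k]) simp_all
  qed
qed

lemma visits_anticoncentration:
  assumes "start_index G \<le> a" "1 \<le> a" "a \<le> n" "finite W"
  shows "pr (\<lambda>s. visits {i} s n \<in> W) \<le>
    (real (Suc a) / real (Suc n)) powr min_rate + 2 * max_rate * real (card W) / real (Suc a)"
proof -
  \<comment> \<open>The mirror image of \<open>W\<close> under \<open>visits_compl\<close>: the
    admissible counts of visits outside \<open>i\<close>. The restriction \<open>v \<le> n\<close>
    keeps truncated subtraction injective.\<close>
  define V where "V = {v. v \<le> n \<and> n - v \<in> W}"
  have "inj_on (\<lambda>v. n - v) V" "(\<lambda>v. n - v) ` V \<subseteq> W" "V \<subseteq> {..n}"
    by (auto simp: V_def inj_on_def)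
  then have V: "finite V" "card V \<le> card W"
    using card_inj_on_le[OF _ _ assms(4)] finite_subset by blast+
  define B where "B k s \<longleftrightarrow> visits {i} s k \<in> W \<and> s k = i" for k s
  define D where "D k s \<longleftrightarrow> visits (-{i}) s k \<in> V \<and> s k \<noteq> i" for k s
  have hB: "hist k (B k)" and hD: "hist k (D k)" for k
    unfolding B_def D_def by (intro hist_conj hist_visits hist_coord order.refl)+
  define F where "F k s \<longleftrightarrow> B k s \<and> s k = i \<and> s (Suc k) \<noteq> i \<or> D k s \<and> s k \<noteq> i \<and> s (Suc k) = i"
    for k s
  have hF: "hist n (F k)" if "k \<in> {a..<n}" for k
    unfolding F_def using that
    by (intro hist_disj hist_conj hist_not hist_coord hist_mono[OF hB] hist_mono[OF hD]) auto
  have F: "pr (F k) \<le> max_rate / Suc a * (pr (B k) + pr (D k))" if "k \<in> {a..<n}" for k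
  proof -
    have "pr (F k) = pr (\<lambda>s. F k s \<and> s k = i) + pr (\<lambda>s. F k s \<and> s k \<noteq> i)"
      by (rule pr_split[OF hF[OF that] hist_coord[OF order.refl]])
    also have "(\<lambda>s. F k s \<and> s k = i) = (\<lambda>s. B k s \<and> s k = i \<and> s (Suc k) \<noteq> i)"
      by (auto simp: F_def fun_eq_iff)
    also have "(\<lambda>s. F k s \<and> s k \<noteq> i) = (\<lambda>s. D k s \<and> s k \<noteq> i \<and> s (Suc k) = i)"
      by (auto simp: F_def fun_eq_iff)
    also have "pr (\<lambda>s. B k s \<and> s k = i \<and> s (Suc k) \<noteq> i) \<le> max_rate / Suc k * pr (\<lambda>s. B k s \<and> s k = i)"
      by (rule leave_le[OF hB])
    also have "(\<lambda>s. B k s \<and> s k = i) = B k" by (auto simp: B_def fun_eq_iff)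
    also have "pr (\<lambda>s. D k s \<and> s k \<noteq> i \<and> s (Suc k) = i) \<le> max_rate / Suc k * pr (\<lambda>s. D k s \<and> s k \<noteq> i)"
      by (rule enter_le[OF hD])
    also have "(\<lambda>s. D k s \<and> s k \<noteq> i) = D k" by (auto simp: D_def fun_eq_iff)
    finally have "pr (F k) \<le> max_rate / Suc k * (pr (B k) + pr (D k))"
      by (simp add: distrib_left add.commute)
    also have "\<dots> \<le> max_rate / Suc a * (pr (B k) + pr (D k))"
      using that max_rate_pos pr_nonneg[of "B k"] pr_nonneg[of "D k"]
      by (intro mult_right_mono divide_left_mono) auto
    finally show ?thesis .
  qed
  have sB: "(\<Sum>k\<in>{a..<n}. pr (B k)) \<le> card W"
    using card_visit_times[OF assms(4,2), of n "{i}"]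
    by (intro sum_pr_le[where n=n]) (auto intro: hist_mono[OF hB] simp: B_def)
  have sD: "(\<Sum>k\<in>{a..<n}. pr (D k)) \<le> card V"
    using card_visit_times[OF V(1) assms(2), of n "-{i}"]
    by (intro sum_pr_le[where n=n]) (auto intro: hist_mono[OF hD] simp: D_def)
  have "pr (\<lambda>s. visits {i} s n \<in> W) \<le> pr (no_change i a n) + (\<Sum>k\<in>{a..<n}. pr (F k))"
  proof (rule pr_union_le[OF _ hF hist_no_change])
    fix s :: "nat \<Rightarrow> 'm" assume W: "visits {i} s n \<in> W"
    show "no_change i a n s \<or> (\<exists>k\<in>{a..<n}. F k s)"
    proof (cases "no_change i a n s")
      case False
      then obtain k where k: "k \<in> {a..<n}"
        "s k = i \<and> s (Suc k) \<noteq> i \<and> visits {i} s k = visits {i} s n \<or>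
         s k \<noteq> i \<and> s (Suc k) = i \<and> visits (-{i}) s k = visits (-{i}) s n"
        by (rule last_change)
      have "visits (-{i}) s n \<le> n" "n - visits (-{i}) s n = visits {i} s n"
        using visits_compl[of "{i}" s n] by auto
      then have "visits (-{i}) s n \<in> V"
        using W by (simp add: V_def)
      with k W have "F k s" by (auto simp: F_def B_def D_def)
      with k(1) show ?thesis by blast
    qed simp
  qed auto
  also have "(\<Sum>k\<in>{a..<n}. pr (F k)) \<le> (\<Sum>k\<in>{a..<n}. max_rate / Suc a * (pr (B k) + pr (D k)))"
    using F by (rule sum_mono)
  also have "\<dots> = max_rate / Suc a * ((\<Sum>k\<in>{a..<n}. pr (B k)) + (\<Sum>k\<in>{a..<n}. pr (D k)))"
    by (simp only: sum_distrib_left[symmetric] sum.distrib)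
  also have "\<dots> \<le> max_rate / Suc a * (real (card W) + real (card W))"
    using sB sD V(2) max_rate_pos by (intro mult_left_mono add_mono) auto
  also have "\<dots> = 2 * max_rate * real (card W) / real (Suc a)"
    by simp
  also have "pr (no_change i a n) \<le> (real (Suc a) / real (Suc n)) powr min_rate"
    using assms by (intro pr_no_change_le) auto
  finally show ?thesis by simp
qed

section \<open>Expectations of test functions\<close>

lemma empirical_measurable [measurable]: "(\<lambda>\<omega>. empirical (\<lambda>k. X k \<omega>) n) \<in> borel_measurable M"
proof -
  have "(\<lambda>\<omega>. axis (X k \<omega>) (1 :: real)) \<in> borel_measurable M" for k
    by (rule measurable_compose[OF X_measurable]) simp
  then show ?thesis
    unfolding empirical_def by measurable
qed

lemma hist_empirical: "k \<le> n \<Longrightarrow> hist n (\<lambda>s. Q (empirical s k))"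
  unfolding hist_def using empirical_cong by (metis order.trans)

lemma integrable_empirical:
  fixes f :: "real ^ 'm \<Rightarrow> real"
  assumes "continuous_on UNIV f" "\<And>y. \<bar>f y\<bar> \<le> 1"
  shows "integrable M (\<lambda>\<omega>. f (empirical (\<lambda>k. X k \<omega>) n))"
proof (rule integrable_const_bound[where B=1])
  show "(\<lambda>\<omega>. f (empirical (\<lambda>k. X k \<omega>) n)) \<in> borel_measurable M"
    using borel_measurable_continuous_onI[OF assms(1)] by measurable
qed (use assms(2) in auto)

lemma integral_empirical_le:
  fixes f :: "real ^ 'm \<Rightarrow> real"
  assumes "continuous_on UNIV f" "\<And>y. \<bar>f y\<bar> \<le> 1" "\<And>s. f (empirical s n) \<le> of_bool (R s)" "hist n R"
  shows "(\<integral>\<omega>. f (empirical (\<lambda>k. X k \<omega>) n) \<partial>M) \<le> pr R"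
proof -
  let ?A = "{\<omega> \<in> space M. R (\<lambda>k. X k \<omega>)}"
  have ev: "?A \<in> events" using assms(4) by (rule hist_event)
  have "(\<integral>\<omega>. f (empirical (\<lambda>k. X k \<omega>) n) \<partial>M) \<le> (\<integral>\<omega>. indicator ?A \<omega> \<partial>M)"
  proof (rule integral_mono)
    fix \<omega> assume "\<omega> \<in> space M"
    then show "f (empirical (\<lambda>k. X k \<omega>) n) \<le> indicator ?A \<omega>"
      using assms(3)[of "\<lambda>k. X k \<omega>"] by (auto simp: indicator_def)
  qed (use ev integrable_empirical[OF assms(1,2)] in \<open>auto simp: integrable_indicator_iff less_top[symmetric]\<close>)
  then show ?thesis using ev by (simp add: pr_def)
qed

lemma integral_empirical_ge:
  fixes f :: "real ^ 'm \<Rightarrow> real"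
  assumes "continuous_on UNIV f" "\<And>y. \<bar>f y\<bar> \<le> 1" "\<And>s. c * of_bool (R s) \<le> f (empirical s n)" "hist n R"
  shows "c * pr R \<le> (\<integral>\<omega>. f (empirical (\<lambda>k. X k \<omega>) n) \<partial>M)"
proof -
  let ?A = "{\<omega> \<in> space M. R (\<lambda>k. X k \<omega>)}"
  have ev: "?A \<in> events" using assms(4) by (rule hist_event)
  have "c * pr R = (\<integral>\<omega>. c * indicator ?A \<omega> \<partial>M)"
    using ev by (simp add: pr_def)
  also have "\<dots> \<le> (\<integral>\<omega>. f (empirical (\<lambda>k. X k \<omega>) n) \<partial>M)"
  proof (rule integral_mono)
    fix \<omega> assume "\<omega> \<in> space M"
    then show "c * indicator ?A \<omega> \<le> f (empirical (\<lambda>k. X k \<omega>) n)"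
      using assms(3)[of "\<lambda>k. X k \<omega>"] by (auto simp: indicator_def)
  qed (use ev integrable_empirical[OF assms(1,2)] in \<open>auto simp: integrable_indicator_iff less_top[symmetric]\<close>)
  finally show ?thesis .
qed

section \<open>Resting in a state and switching to another\<close>

text \<open>Each step keeps the state with conditional probability at least
  \<open>1 - max_rate / N\<close>, hence at least \<open>exp (- 2 * max_rate / N)\<close>. For
  \<open>k\<close> of order \<open>N\<close> the product stays bounded away from 0.\<close>

lemma pr_stay_ge:
  assumes "hist N R" "0 < N" "2 * max_rate \<le> real N"
  shows "exp (- 2 * max_rate / real N) ^ k * pr (\<lambda>s. R s \<and> s N = i)
    \<le> pr (\<lambda>s. R s \<and> (\<forall>l\<in>{N..N + k}. s l = i))"
proof (induction k)
  case 0
  then show ?case by simp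
next
  case (Suc k)
  let ?A = "\<lambda>s. R s \<and> (\<forall>l\<in>{N..N + k}. s l = i)"
  define x where "x = max_rate / real N"
  have x: "0 \<le> x" "x \<le> 1 / 2"
    using assms(2,3) max_rate_pos by (auto simp: x_def divide_simps)
  have h: "hist (N + k) ?A"
    by (intro hist_conj hist_ball hist_coord hist_mono[OF assms(1)]) auto
  have A: "(\<lambda>s. ?A s \<and> s (N + k) = i) = ?A" by auto
  have "pr (\<lambda>s. ?A s \<and> s (N + k) = i \<and> s (Suc (N + k)) \<noteq> i) \<le> max_rate / Suc (N + k) * pr ?A"
    using leave_le[OF h, of i] unfolding A .
  also have "\<dots> \<le> x * pr ?A"
    unfolding x_def using assms(2) max_rate_pos
    by (intro mult_right_mono divide_left_mono pr_nonneg) auto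
  also have "(\<lambda>s. ?A s \<and> s (N + k) = i \<and> s (Suc (N + k)) \<noteq> i) = (\<lambda>s. ?A s \<and> \<not> s (Suc (N + k)) = i)"
    by auto
  finally have "pr (\<lambda>s. ?A s \<and> \<not> s (Suc (N + k)) = i) \<le> x * pr ?A" .
  moreover have "pr ?A = pr (\<lambda>s. ?A s \<and> s (Suc (N + k)) = i) + pr (\<lambda>s. ?A s \<and> \<not> s (Suc (N + k)) = i)"
    by (rule pr_split[OF h hist_coord[OF order.refl]])
  ultimately have "(1 - x) * pr ?A \<le> pr (\<lambda>s. ?A s \<and> s (Suc (N + k)) = i)"
    by (simp add: algebra_simps)
  moreover have "pr (\<lambda>s. ?A s \<and> s (Suc (N + k)) = i) = pr (\<lambda>s. R s \<and> (\<forall>l\<in>{N..N + Suc k}. s l = i))"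
    by (rule arg_cong[where f=pr]) (auto simp: fun_eq_iff atLeastAtMostSuc_conv)
  moreover have "exp (- 2 * x) * pr ?A \<le> (1 - x) * pr ?A"
    using exp_minus_double_le[OF x] by (intro mult_right_mono pr_nonneg)
  moreover have "exp (- 2 * x) * (exp (- 2 * x) ^ k * pr (\<lambda>s. R s \<and> s N = i)) \<le> exp (- 2 * x) * pr ?A"
    using Suc.IH by (intro mult_left_mono) (auto simp: x_def)
  moreover have "exp (- 2 * max_rate / real N) ^ Suc k * pr (\<lambda>s. R s \<and> s N = i) =
      exp (- 2 * x) * (exp (- 2 * x) ^ k * pr (\<lambda>s. R s \<and> s N = i))"
    by (simp add: x_def)
  ultimately show ?case
    by linarith
qed

text \<open>Let \<open>q\<close> be the probability of \<open>R\<close> with the chain in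
  \<open>j\<close>. Outflow at rate at most \<open>max_rate\<close> and inflow at rate at least
  \<open>min_rate\<close> give a next value of at least
  \<open>(1 - \<kappa>) * q + \<kappa> * p\<close>, where \<open>p\<close> is the balance point of
  these two rates. So any deficit below \<open>p\<close> shrinks by the factor
  \<open>1 - \<kappa>\<close>.\<close>

lemma pr_switch_ge:
  assumes "hist N R" "start_index G \<le> N" "max_rate + min_rate \<le> real N" "N + k \<le> n"
  shows "min_rate / (max_rate + min_rate) * pr R * (1 - (1 - (max_rate + min_rate) / real n) ^ k)
    \<le> pr (\<lambda>s. R s \<and> s (N + k) = j)"
  using assms(4)
proof (induction k)
  case 0
  then show ?case by (simp add: pr_nonneg)
next
  case (Suc k)
  let ?m = "N + k"
  define K where "K = max_rate + min_rate"
  define p where "p = min_rate / K * pr R"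
  define r where "r = (1 - K / real n) ^ k"
  define \<kappa> where "\<kappa> = K / real (Suc ?m)"
  define q where "q = pr (\<lambda>s. R s \<and> s ?m = j)"
  have K: "0 < K" "K \<le> real N"
    using max_rate_pos min_rate_pos assms(3) by (auto simp: K_def)
  then have "K \<le> real n" "0 < real n" using Suc.prems by linarith+
  then have \<kappa>: "K / real n \<le> \<kappa>" "\<kappa> \<le> 1" "K / real n \<le> 1"
    using K Suc.prems by (auto simp: \<kappa>_def intro!: divide_left_mono)
  have p: "0 \<le> p" using K min_rate_pos by (auto simp: p_def pr_nonneg)
  have r: "0 \<le> r" using \<kappa> by (simp add: r_def)
  have h: "hist ?m R" using hist_mono[OF assms(1)] by simp
  have hq: "hist ?m (\<lambda>s. s ?m = j)" by (rule hist_coord[OF order.refl])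
  have hj: "hist (Suc ?m) (\<lambda>s. s (Suc ?m) = j)" by (rule hist_coord[OF order.refl])
  have "pr R = q + pr (\<lambda>s. R s \<and> s ?m \<noteq> j)"
    unfolding q_def by (rule pr_split[OF h hq])
  then have "min_rate / Suc ?m * (pr R - q) \<le> pr (\<lambda>s. R s \<and> s ?m \<noteq> j \<and> s (Suc ?m) = j)"
    using enter_ge[OF h, of j] assms(2) by simp
  moreover have "q = pr (\<lambda>s. (R s \<and> s ?m = j) \<and> s (Suc ?m) = j) + pr (\<lambda>s. (R s \<and> s ?m = j) \<and> s (Suc ?m) \<noteq> j)"
    unfolding q_def by (rule pr_split[OF hist_conj[OF h hq] hj])
  moreover have "pr (\<lambda>s. (R s \<and> s ?m = j) \<and> s (Suc ?m) \<noteq> j) \<le> max_rate / Suc ?m * q"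
    using leave_le[OF h, of j] by (simp add: q_def conj_assoc)
  moreover have "pr (\<lambda>s. R s \<and> s (Suc ?m) = j) =
      pr (\<lambda>s. (R s \<and> s (Suc ?m) = j) \<and> s ?m = j) + pr (\<lambda>s. (R s \<and> s (Suc ?m) = j) \<and> s ?m \<noteq> j)"
    by (rule pr_split[OF hist_conj[OF hist_mono[OF h] hj] hq]) simp
  moreover have "(\<lambda>s. (R s \<and> s (Suc ?m) = j) \<and> s ?m = j) = (\<lambda>s. (R s \<and> s ?m = j) \<and> s (Suc ?m) = j)"
    "(\<lambda>s. (R s \<and> s (Suc ?m) = j) \<and> s ?m \<noteq> j) = (\<lambda>s. R s \<and> s ?m \<noteq> j \<and> s (Suc ?m) = j)"
    by auto
  ultimately have "q - max_rate / Suc ?m * q + min_rate / Suc ?m * (pr R - q) \<le> pr (\<lambda>s. R s \<and> s (Suc ?m) = j)"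
    by simp
  moreover have "q - max_rate / Suc ?m * q + min_rate / Suc ?m * (pr R - q) = (1 - \<kappa>) * q + \<kappa> * p"
  proof -
    have "\<kappa> * p = min_rate / Suc ?m * pr R" using K(1) by (simp add: \<kappa>_def p_def)
    moreover have "\<kappa> * q = max_rate / Suc ?m * q + min_rate / Suc ?m * q"
      by (simp add: \<kappa>_def K_def add_divide_distrib distrib_right)
    ultimately show ?thesis by (simp only: left_diff_distrib right_diff_distrib mult_1_left)
  qed
  moreover have "(1 - \<kappa>) * (p * (1 - r)) \<le> (1 - \<kappa>) * q"
    using Suc \<kappa>(2) unfolding q_def p_def r_def K_def by (intro mult_left_mono) auto
  moreover have "(1 - \<kappa>) * (p * (1 - r)) + \<kappa> * p = p * (1 - (1 - \<kappa>) * r)"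
    by (simp add: algebra_simps)
  \<comment> \<open>The factor \<open>\<kappa>\<close> varies with the step; its lower bound
    \<open>K / n\<close> yields a geometric estimate.\<close>
  moreover have "p * (1 - (1 - K / real n) * r) \<le> p * (1 - (1 - \<kappa>) * r)"
    using \<kappa> p r by (intro mult_left_mono diff_mono mult_right_mono) auto
  ultimately have "p * (1 - (1 - K / real n) * r) \<le> pr (\<lambda>s. R s \<and> s (Suc ?m) = j)"
    by linarith
  then show ?case
    by (simp add: p_def r_def K_def)
qed

section \<open>Accessibility of the points of the simplex\<close>

text \<open>The lower bound is uniform over all large \<open>n\<close>, since mere positivity for
  each \<open>n\<close> could be lost in the limit.\<close>

definition near :: "real ^ 'm \<Rightarrow> real \<Rightarrow> bool" where
  "near z e \<longleftrightarrow> (\<exists>c>0. \<forall>\<^sub>F n in sequentially. c \<le> pr (\<lambda>s. dist (empirical s n) z < e))"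

text \<open>Also records the current state, which must be known before a long stay can be
  appended.\<close>

definition near_in :: "'m \<Rightarrow> real ^ 'm \<Rightarrow> real \<Rightarrow> bool" where
  "near_in i z e \<longleftrightarrow>
    (\<exists>c>0. \<forall>\<^sub>F n in sequentially. c \<le> pr (\<lambda>s. dist (empirical s n) z < e \<and> s n = i))"

text \<open>The switch takes place during the last fraction \<open>\<delta>\<close> of the time.
  This moves the occupation vector by about \<open>2 * \<delta>\<close> at most, yet order
  \<open>\<delta> * n\<close> steps reach \<open>j\<close> with probability bounded below.\<close>

lemma near_switch:
  assumes "near z e" "e < e'"
  shows "near_in j z e'"
proof -
  obtain c where c: "c > 0" "\<forall>\<^sub>F n in sequentially. c \<le> pr (\<lambda>s. dist (empirical s n) z < e)"
    using assms(1) by (auto simp: near_def)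
  \<comment> \<open>Half of the gap \<open>e' - e\<close> pays for the displacement
    \<open>2 * \<delta>\<close>, the other half for the rounding term \<open>2 / n\<close>. The cap
    \<open>1 / 2\<close> keeps \<open>1 - \<delta>\<close> positive.\<close>
  define \<delta> where "\<delta> = min (1 / 2) ((e' - e) / 4)"
  have \<delta>: "0 < \<delta>" "\<delta> \<le> 1 / 2"
    using assms(2) by (auto simp: \<delta>_def)
  have "\<delta> \<le> (e' - e) / 4"
    unfolding \<delta>_def by (rule min.cobounded2)
  then have \<delta>4: "4 * \<delta> \<le> e' - e" by (simp add: field_simps)
  define f where "f n = nat \<lfloor>(1 - \<delta>) * real n\<rfloor>" for n
  have f: "real (f n) \<le> (1 - \<delta>) * real n" "(1 - \<delta>) * real n - 1 < real (f n)" "f n \<le> n" for n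
    unfolding f_def using \<delta> by (intro floor_fraction; simp)+
  have lim: "filterlim f sequentially sequentially"
    unfolding f_def using \<delta> by (intro floor_fraction) auto
  define K where "K = max_rate + min_rate"
  have K: "0 < K" using max_rate_pos min_rate_pos by (simp add: K_def)
  \<comment> \<open>The bound of \<open>pr_switch_ge\<close>, where at least
    \<open>\<delta> * n\<close> steps make the geometric term at most
    \<open>exp (- K * \<delta>)\<close>.\<close>
  define c' where "c' = min_rate / K * c * (1 - exp (- K * \<delta>))"
  have c': "0 < c'"
    using K c(1) \<delta>(1) min_rate_pos by (auto simp: c'_def)
  have "\<forall>\<^sub>F n in sequentially. c \<le> pr (\<lambda>s. dist (empirical s (f n)) z < e)"
    by (rule eventually_compose_filterlim[OF c(2) lim])
  moreover have "\<forall>\<^sub>F n in sequentially. max (Suc (start_index G)) (nat \<lceil>K\<rceil>) \<le> f n"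
    by (rule eventually_compose_filterlim[OF eventually_ge_at_top lim])
  moreover have "\<forall>\<^sub>F n in sequentially. max 1 (nat \<lceil>4 / (e' - e)\<rceil>) < n"
    by (rule eventually_gt_at_top)
  ultimately have "\<forall>\<^sub>F n in sequentially. c' \<le> pr (\<lambda>s. dist (empirical s n) z < e' \<and> s n = j)"
  proof eventually_elim
    case (elim n)
    let ?N = "f n" and ?R = "\<lambda>s. dist (empirical s (f n)) z < e"
    have N: "0 < ?N" "start_index G \<le> ?N" "K \<le> real ?N" using elim(2) by linarith+
    have n: "0 < real n" "4 / (e' - e) < real n" using elim(3) by linarith+
    have hR: "hist ?N ?R" by (rule hist_empirical[OF order.refl])
    have "K \<le> real n" using N(3) f(3)[of n] by linarith
    then have "(1 - K / real n) ^ (n - ?N) \<le> exp (- K / real n) ^ (n - ?N)"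
      using n exp_ge_add_one_self[of "- K / real n"] by (intro power_mono) auto
    also have "\<dots> = exp (- K * (real (n - ?N) / real n))"
      by (simp add: exp_of_nat_mult[symmetric])
    also have "exp (- K * (real (n - ?N) / real n)) \<le> exp (- K * \<delta>)"
    proof -
      have "\<delta> \<le> real (n - ?N) / real n"
        using n(1) f(1)[of n] f(3)[of n] by (simp add: of_nat_diff field_simps)
      then show ?thesis
        using mult_left_mono[of \<delta> "real (n - ?N) / real n" K] K by simp
    qed
    finally have "c' \<le> min_rate / K * pr ?R * (1 - (1 - K / real n) ^ (n - ?N))"
      unfolding c'_def using K min_rate_pos elim(1) c(1) \<delta>(1) pr_nonneg[of ?R]
      by (intro mult_mono) auto
    also have "\<dots> \<le> pr (\<lambda>s. ?R s \<and> s (?N + (n - ?N)) = j)"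
      unfolding K_def using N f(3)[of n] by (intro pr_switch_ge[OF hR]) (auto simp: K_def)
    also have "?N + (n - ?N) = n" using f(3)[of n] by simp
    also have "pr (\<lambda>s. ?R s \<and> s n = j) \<le> pr (\<lambda>s. dist (empirical s n) z < e' \<and> s n = j)"
    proof (rule pr_mono[where n=n])
      fix s :: "nat \<Rightarrow> 'm" assume s: "?R s \<and> s n = j"
      have "dist (empirical s n) (empirical s ?N) \<le> 2 * (real n - real ?N) / real n"
        using f(3) N(1) by (rule dist_empirical_le)
      also have "\<dots> < 2 * (\<delta> * real n + 1) / real n"
        using f(2)[of n] n(1) by (intro divide_strict_right_mono) (auto simp: algebra_simps)
      also have "\<dots> = 2 * \<delta> + 2 / real n"
        using n(1) by (simp add: field_simps)
      also have "2 / real n \<le> (e' - e) / 2"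
        using n assms(2) by (simp add: field_simps)
      also have "2 * \<delta> + (e' - e) / 2 \<le> e' - e"
        using \<delta>4 by (simp add: field_simps)
      finally show "dist (empirical s n) z < e' \<and> s n = j"
        using s dist_triangle[of "empirical s n" z "empirical s ?N"] by auto
    qed (intro hist_conj hist_empirical hist_coord order.refl)
    finally show ?case .
  qed
  with c' show ?thesis by (auto simp: near_in_def)
qed

text \<open>Resting in \<open>i\<close> from about time \<open>(1 - t) * n\<close> up to
  \<open>n\<close> sends \<open>z\<close> to the point of the segment with parameter
  \<open>t\<close> and contracts errors by about \<open>1 - t\<close>. The strict inequality for
  \<open>e'\<close> absorbs rounding.\<close>

lemma near_stay:
  assumes "near_in i z e" "0 \<le> t" "t < 1" "(1 - t) * e < e'"
  shows "near ((1 - t) *\<^sub>R z + t *\<^sub>R axis i 1) e'"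
proof -
  obtain c where c: "c > 0" "\<forall>\<^sub>F n in sequentially. c \<le> pr (\<lambda>s. dist (empirical s n) z < e \<and> s n = i)"
    using assms(1) by (auto simp: near_in_def)
  define f where "f n = nat \<lfloor>(1 - t) * real n\<rfloor>" for n
  have f: "real (f n) \<le> (1 - t) * real n" "(1 - t) * real n - 1 < real (f n)" "f n \<le> n" for n
    unfolding f_def using assms(2,3) by (intro floor_fraction; simp)+
  have lim: "filterlim f sequentially sequentially"
    unfolding f_def using assms(2,3) by (intro floor_fraction) auto
  \<comment> \<open>For large \<open>n\<close> one has \<open>n \<le> 2 * f n / (1 - t)\<close>, so
    the survival factor over \<open>n - f n\<close> steps is at least this exponential.\<close>
  define c' where "c' = exp (- 4 * max_rate / (1 - t)) * c"
  have c': "0 < c'" using c(1) by (simp add: c'_def)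
  define d where "d = e' - (1 - t) * e"
  have d: "0 < d" using assms(4) by (simp add: d_def)
  define D where "D = norm (z - axis i 1)"
  have "\<forall>\<^sub>F n in sequentially. c \<le> pr (\<lambda>s. dist (empirical s (f n)) z < e \<and> s (f n) = i)"
    by (rule eventually_compose_filterlim[OF c(2) lim])
  moreover have "\<forall>\<^sub>F n in sequentially. max 1 (nat \<lceil>2 * max_rate\<rceil>) \<le> f n"
    by (rule eventually_compose_filterlim[OF eventually_ge_at_top lim])
  moreover have "\<forall>\<^sub>F n in sequentially. max (nat \<lceil>2 / (1 - t)\<rceil>) (nat \<lceil>D / d\<rceil>) < n"
    by (rule eventually_gt_at_top)
  ultimately have "\<forall>\<^sub>F n in sequentially. c' \<le> pr (\<lambda>s. dist (empirical s n) ((1 - t) *\<^sub>R z + t *\<^sub>R axis i 1) < e')"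
  proof eventually_elim
    case (elim n)
    let ?N = "f n" and ?R = "\<lambda>s. dist (empirical s (f n)) z < e"
    have N: "0 < ?N" "2 * max_rate \<le> real ?N" using elim(2) by linarith+
    have n: "0 < real n" "2 / (1 - t) < real n" "D / d < real n"
      using elim(3) by linarith+
    have hR: "hist ?N ?R" by (rule hist_empirical[OF order.refl])
    have "2 < (1 - t) * real n"
      using n(2) assms(3) by (simp add: field_simps)
    then have "real n * (1 - t) \<le> 2 * real ?N"
      using f(2)[of n] by (simp add: mult.commute)
    then have nN: "real n / real ?N \<le> 2 / (1 - t)"
      using N(1) assms(3) by (simp add: field_simps)
    have "real (n - ?N) / real ?N \<le> real n / real ?N"
      by (intro divide_right_mono) auto
    also note nN
    finally have "max_rate * (real (n - ?N) / real ?N) \<le> max_rate * (2 / (1 - t))"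
      using max_rate_pos by (intro mult_left_mono) auto
    then have "- 2 * (max_rate * (2 / (1 - t))) \<le> - 2 * (max_rate * (real (n - ?N) / real ?N))"
      by linarith
    also have "\<dots> = real (n - ?N) * (- 2 * max_rate / real ?N)" by simp
    finally have "exp (- 4 * max_rate / (1 - t)) \<le> exp (- 2 * max_rate / real ?N) ^ (n - ?N)"
      by (simp add: exp_of_nat_mult[symmetric])
    then have "c' \<le> exp (- 2 * max_rate / real ?N) ^ (n - ?N) * pr (\<lambda>s. ?R s \<and> s ?N = i)"
      unfolding c'_def using elim(1) c(1) by (intro mult_mono) auto
    also have "\<dots> \<le> pr (\<lambda>s. ?R s \<and> (\<forall>l\<in>{?N..?N + (n - ?N)}. s l = i))"
      by (rule pr_stay_ge[OF hR N])
    also have "?N + (n - ?N) = n" using f(3)[of n] by simp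
    also have "pr (\<lambda>s. ?R s \<and> (\<forall>l\<in>{?N..n}. s l = i)) \<le>
        pr (\<lambda>s. dist (empirical s n) ((1 - t) *\<^sub>R z + t *\<^sub>R axis i 1) < e')"
    proof (rule pr_mono[OF _ hist_empirical[OF order.refl]])
      fix s :: "nat \<Rightarrow> 'm" assume s: "?R s \<and> (\<forall>l\<in>{?N..n}. s l = i)"
      define u where "u = real ?N / real n"
      have u: "0 \<le> u" "u \<le> 1 - t"
        using n(1) f(1)[of n] by (auto simp: u_def field_simps)
      have "u - (1 - t) = (real ?N - (1 - t) * real n) / real n"
        using n(1) by (simp add: u_def field_simps)
      also have "\<bar>\<dots>\<bar> \<le> 1 / real n"
        unfolding abs_divide using f(1,2)[of n] by (auto intro!: divide_right_mono)
      finally have u1: "\<bar>u - (1 - t)\<bar> \<le> 1 / real n" .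
      have "empirical s n = u *\<^sub>R empirical s ?N + (1 - u) *\<^sub>R axis i 1"
        unfolding u_def using s by (intro empirical_stay f N) auto
      \<comment> \<open>The error splits into the old error, scaled by \<open>u \<le> 1 - t\<close>,
        and the rounding of the weight, of size at most \<open>D / n < d\<close>.\<close>
      then have "empirical s n - ((1 - t) *\<^sub>R z + t *\<^sub>R axis i 1) =
          u *\<^sub>R (empirical s ?N - z) + (u - (1 - t)) *\<^sub>R (z - axis i 1)"
        by (simp add: algebra_simps)
      then have "dist (empirical s n) ((1 - t) *\<^sub>R z + t *\<^sub>R axis i 1) \<le>
          u * dist (empirical s ?N) z + \<bar>u - (1 - t)\<bar> * D"
        using norm_triangle_ineq[of "u *\<^sub>R (empirical s ?N - z)" "(u - (1 - t)) *\<^sub>R (z - axis i 1)"] u(1)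
        by (simp add: dist_norm D_def)
      also have "\<dots> \<le> (1 - t) * e + (1 / real n) * D"
        using s u u1 by (intro add_mono mult_mono) (auto simp: D_def)
      also have "(1 / real n) * D < d"
        using n(1,3) d by (simp add: field_simps)
      finally show "dist (empirical s n) ((1 - t) *\<^sub>R z + t *\<^sub>R axis i 1) < e'"
        by (simp add: d_def)
    qed
    finally show ?case .
  qed
  with c' show ?thesis by (auto simp: near_def)
qed

definition accessible :: "real ^ 'm \<Rightarrow> bool" where
  "accessible z \<longleftrightarrow> (\<forall>e>0. near z e)"

text \<open>The preparatory switch to \<open>i\<close> enlarges the radius slightly; the strict
  inequality leaves room for an intermediate radius \<open>e''\<close>.\<close>

lemma near_segment:
  assumes "near z e" "0 \<le> t" "t < 1" "(1 - t) * e < e'"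
  shows "near ((1 - t) *\<^sub>R z + t *\<^sub>R axis i 1) e'"
proof -
  have "e < e' / (1 - t)"
    using assms(3,4) by (simp add: field_simps)
  then obtain e'' where e: "e < e''" "e'' < e' / (1 - t)"
    using dense by blast
  then have "(1 - t) * e'' < e'"
    using assms(3) by (simp add: field_simps)
  with near_stay[OF near_switch[OF assms(1) e(1)] assms(2,3)] show ?thesis by blast
qed

text \<open>Every occupation vector is within distance 2 of the vertex, so radius 3 holds with
  probability 1. A stay with \<open>t\<close> close to 1 contracts this radius below
  \<open>e\<close> and fixes the vertex itself.\<close>

lemma accessible_axis: "accessible (axis i 1)"
  unfolding accessible_def
proof (intro allI impI)
  fix e :: real assume "0 < e"
  have "near (axis i 1) 3"
  proof -
    have "dist (empirical s n) (axis i 1) < 3" for s :: "nat \<Rightarrow> 'm" and n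
      using norm_triangle_ineq4[of "empirical s n" "axis i 1"] norm_empirical_le[of s n]
      by (simp add: dist_norm)
    then show ?thesis
      unfolding near_def by (intro exI[of _ 1]) (simp add: pr_True)
  qed
  define t where "t = max 0 (1 - e / 4)"
  have "0 \<le> t" "t < 1" "(1 - t) * 3 < e"
    using \<open>0 < e\<close> by (auto simp: t_def max_def field_simps)
  from near_segment[OF \<open>near (axis i 1) 3\<close> this, of i] show "near (axis i 1) e"
    by (simp add: scaleR_add_left[symmetric])
qed

lemma accessible_segment:
  assumes "accessible z" "0 \<le> t" "t \<le> 1"
  shows "accessible ((1 - t) *\<^sub>R z + t *\<^sub>R axis i 1)"
proof (cases "t = 1")
  case True
  then show ?thesis using accessible_axis by simp
next
  case False
  show ?thesis
    unfolding accessible_def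
  proof (intro allI impI)
    fix e :: real assume "0 < e"
    then have "near z (e / 2)" using assms(1) by (simp add: accessible_def)
    moreover have "(1 - t) * (e / 2) \<le> 1 * (e / 2)"
      using assms(2,3) \<open>0 < e\<close> by (intro mult_right_mono) auto
    ultimately show "near ((1 - t) *\<^sub>R z + t *\<^sub>R axis i 1) e"
      using assms(2,3) False \<open>0 < e\<close> by (intro near_segment[of z "e / 2"]) auto
  qed
qed

text \<open>Adding a vertex to \<open>F\<close> replaces the hull by the union of segments from the
  old hull to that vertex, and \<open>accessible_segment\<close> covers each of them.\<close>

lemma accessible_hull:
  assumes "finite F" "x \<in> convex hull ((\<lambda>i. axis i 1) ` F)"
  shows "accessible x"
  using assms
proof (induction F arbitrary: x rule: finite_induct)
  case empty
  then show ?case by simp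
next
  case (insert i F)
  show ?case
  proof (cases "F = {}")
    case True
    then show ?thesis using insert.prems accessible_axis by simp
  next
    case False
    then obtain u y where "0 \<le> u" "u \<le> 1" "y \<in> convex hull ((\<lambda>i. axis i 1) ` F)"
      "x = (1 - u) *\<^sub>R axis i 1 + u *\<^sub>R y"
      using insert.prems by (auto simp: convex_hull_insert_alt)
    with accessible_segment[OF insert.IH, of y "1 - u" i] show ?thesis
      by (simp add: add.commute)
  qed
qed

lemma accessible_simplex: "x \<in> prob_simplex \<Longrightarrow> accessible x"
  by (rule accessible_hull[of UNIV]) (simp, rule subsetD[OF prob_simplex_subset_hull])

end

section \<open>Passage to the limit law\<close>

locale limiting_chain = generator_chain G M X \<pi>
  for G :: "real ^ 'm ^ 'm" and M :: "'w measure" and X :: "nat \<Rightarrow> 'w \<Rightarrow> 'm" and \<pi> :: "'m pmf" +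
  fixes \<mu> :: "(real ^ 'm) measure"
  assumes limit: "limit_in_distribution prob_simplex M (occupation X) \<mu>"
begin

lemma sets_mu: "sets \<mu> = sets (restrict_space borel prob_simplex)"
  and prob_space_mu: "prob_space \<mu>"
  using limit by (auto simp: limit_in_distribution_def prob_measure_on_def)

lemma space_mu: "space \<mu> = prob_simplex"
  using sets_eq_imp_space_eq[OF sets_mu] by (simp add: space_restrict_space)

sublocale mu: prob_space \<mu>
  by (rule prob_space_mu)

lemma limit_test:
  fixes f :: "real ^ 'm \<Rightarrow> real"
  assumes "continuous_on UNIV f" "\<And>y. \<bar>f y\<bar> \<le> 1"
  shows "(\<lambda>n. \<integral>\<omega>. f (empirical (\<lambda>k. X k \<omega>) n) \<partial>M) \<longlonglongrightarrow> (\<integral>x. f x \<partial>\<mu>)"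
proof -
  have "continuous_on prob_simplex f"
    using assms(1) continuous_on_subset by blast
  moreover have "bounded (f ` prob_simplex)"
    using assms(2) by (auto simp: bounded_iff)
  ultimately show ?thesis
    using limit by (simp add: limit_in_distribution_def occupation_eq_empirical)
qed

lemma integrable_test:
  fixes f :: "real ^ 'm \<Rightarrow> real"
  assumes "continuous_on UNIV f" "\<And>y. \<bar>f y\<bar> \<le> 1"
  shows "integrable \<mu> f"
proof (rule mu.integrable_const_bound[where B=1])
  show "f \<in> borel_measurable \<mu>"
    using borel_measurable_continuous_onI[OF assms(1)]
    by (subst measurable_cong_sets[OF sets_mu refl]) (rule measurable_restrict_space1)
qed (use assms(2) in auto)

text \<open>One coordinate suffices. A strip of half-width \<open>1 / b\<^sup>2\<close> around
  \<open>x $ i\<close> admits at most \<open>2 * a + 1\<close> visit counts at time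
  \<open>n = b\<^sup>2 * a\<close>. Looking for changes from time \<open>b * a\<close> on makes both
  anticoncentration terms small: \<open>b * a / n\<close> is \<open>1 / b\<close>, and
  \<open>card W / (b * a)\<close> is at most \<open>3 / b\<close>.\<close>

lemma measure_point_le:
  assumes "x \<in> prob_simplex" "1 \<le> b"
  shows "measure \<mu> {x} \<le> (2 / real b) powr min_rate + 6 * max_rate / real b"
proof -
  \<comment> \<open>An arbitrary coordinate.\<close>
  define i :: 'm where "i = undefined"
  define B where "B = (real b)\<^sup>2"
  have B: "1 \<le> B" using assms(2) by (simp add: B_def)
  \<comment> \<open>A continuous tent over the strip: it is 1 at \<open>x\<close> and vanishes once
    the coordinate differs by \<open>1 / B\<close> or more.\<close>
  define f where "f y = max 0 (1 - B * \<bar>y $ i - x $ i\<bar>)" for y :: "real ^ 'm"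
  have f: "continuous_on UNIV f"
    unfolding f_def by (intro continuous_intros)
  have f1: "\<bar>f y\<bar> \<le> 1" for y
    using mult_nonneg_nonneg[of B "\<bar>y $ i - x $ i\<bar>"] B unfolding f_def by linarith
  have x: "{x} \<in> sets \<mu>"
    unfolding sets_mu sets_restrict_space by (rule image_eqI[of _ _ "{x}"]) (use assms(1) in auto)
  have "measure \<mu> {x} = (\<integral>y. indicator {x} y \<partial>\<mu>)"
    using x by simp
  also have "\<dots> \<le> (\<integral>y. f y \<partial>\<mu>)"
  proof (rule integral_mono)
    show "indicator {x} y \<le> f y" for y
      by (simp add: indicator_def f_def)
  qed (use x integrable_test[OF f f1] in \<open>auto simp: integrable_indicator_iff less_top[symmetric]\<close>)
  also have "\<dots> \<le> (2 / real b) powr min_rate + 6 * max_rate / real b"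
  proof (rule LIMSEQ_le_const2)
    \<comment> \<open>Since the full sequence converges, times divisible by \<open>b\<^sup>2\<close>
      are enough and avoid rounding.\<close>
    have "strict_mono (\<lambda>a. b\<^sup>2 * a)"
      using assms(2) by (auto simp: strict_mono_def)
    from LIMSEQ_subseq_LIMSEQ[OF limit_test[OF f f1] this]
    show "(\<lambda>a. \<integral>\<omega>. f (empirical (\<lambda>k. X k \<omega>) (b\<^sup>2 * a)) \<partial>M) \<longlonglongrightarrow> (\<integral>y. f y \<partial>\<mu>)"
      by (simp add: o_def)
    have "(\<integral>\<omega>. f (empirical (\<lambda>k. X k \<omega>) (b\<^sup>2 * a)) \<partial>M)
        \<le> (2 / real b) powr min_rate + 6 * max_rate / real b"
      if a: "max 1 (start_index G) \<le> a" for a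
    proof -
      define n where "n = b\<^sup>2 * a"
      have n: "0 < n" "real n = B * real a" "b * a \<le> n"
        using a assms(2) by (auto simp: n_def B_def power2_eq_square)
      have ba: "a \<le> b * a" using assms(2) by simp
      define W where "W = {v :: nat. \<bar>real v - x $ i * real n\<bar> \<le> real a}"
      have W: "finite W" "card W \<le> 2 * a + 1"
        unfolding W_def by (rule card_near)+
      have "(\<integral>\<omega>. f (empirical (\<lambda>k. X k \<omega>) n) \<partial>M) \<le> pr (\<lambda>s. visits {i} s n \<in> W)"
      proof (rule integral_empirical_le[OF f f1])
        fix s :: "nat \<Rightarrow> 'm"
        have "\<bar>real (visits {i} s n) - x $ i * real n\<bar> = real n * \<bar>empirical s n $ i - x $ i\<bar>"
          using n(1) by (simp add: empirical_nth abs_if field_simps)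
        also have "\<dots> = (B * \<bar>empirical s n $ i - x $ i\<bar>) * real a"
          by (simp add: n)
        finally have "visits {i} s n \<in> W" if "B * \<bar>empirical s n $ i - x $ i\<bar> \<le> 1"
          using mult_right_mono[OF that, of "real a"] by (simp add: W_def)
        then show "f (empirical s n) \<le> of_bool (visits {i} s n \<in> W)"
          using f1[of "empirical s n"]
          by (cases "B * \<bar>empirical s n $ i - x $ i\<bar> \<le> 1") (auto simp: f_def)
      qed (rule hist_visits[OF order.refl])
      also have "\<dots> \<le> (real (Suc (b * a)) / real (Suc n)) powr min_rate +
          2 * max_rate * real (card W) / real (Suc (b * a))"
        using a ba n by (intro visits_anticoncentration W(1)) linarith+
      also have "\<dots> \<le> (2 / real b) powr min_rate + 6 * max_rate / real b"
      proof (rule add_mono)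
        \<comment> \<open>The factor 2 absorbs the successor: the product is \<open>n + b\<close>,
          and \<open>b \<le> n\<close>.\<close>
        have "real (Suc (b * a)) * real b \<le> 2 * real (Suc n)"
        proof -
          have "b \<le> b\<^sup>2 * a" using a assms(2) by (simp add: power2_eq_square)
          then have "real b \<le> real n" unfolding n_def by (rule of_nat_mono)
          moreover have "real (Suc (b * a)) * real b = real n + real b"
            by (simp add: n_def power2_eq_square algebra_simps)
          ultimately show ?thesis by simp
        qed
        then have "real (Suc (b * a)) / real (Suc n) \<le> 2 / real b"
          using assms(2) by (simp add: divide_simps)
        then show "(real (Suc (b * a)) / real (Suc n)) powr min_rate \<le> (2 / real b) powr min_rate"
          using min_rate_pos by (intro powr_mono2) auto
        \<comment> \<open>Because \<open>a \<ge> 1\<close>, \<open>2 * a + 1 \<le> 3 * a\<close>;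
          with the factor 2 of the anticoncentration bound this gives the constant 6.\<close>
        have "real (card W) * real b \<le> 3 * real (Suc (b * a))"
        proof -
          have "real (card W) \<le> 3 * real a" using W(2) a by simp
          then have "real (card W) * real b \<le> 3 * real a * real b"
            by (rule mult_right_mono) simp
          moreover have "real (Suc (b * a)) = real a * real b + 1" by simp
          ultimately show ?thesis by (simp only:) simp
        qed
        then have "real (card W) / real (Suc (b * a)) \<le> 3 / real b"
          using assms(2) by (simp add: divide_simps del: of_nat_Suc of_nat_mult)
        from mult_left_mono[OF this, of "2 * max_rate"] max_rate_pos
        show "2 * max_rate * real (card W) / real (Suc (b * a)) \<le> 6 * max_rate / real b"
          by simp
      qed
      finally show ?thesis by (simp add: n_def)
    qed
    then show "\<exists>N. \<forall>a\<ge>N. (\<integral>\<omega>. f (empirical (\<lambda>k. X k \<omega>) (b\<^sup>2 * a)) \<partial>M)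
        \<le> (2 / real b) powr min_rate + 6 * max_rate / real b" by blast
  qed
  finally show ?thesis .
qed

lemma no_atoms:
  assumes "x \<in> prob_simplex"
  shows "measure \<mu> {x} = 0"
proof -
  have "(\<lambda>b. (2 / real b) powr min_rate + 6 * max_rate / real b) \<longlonglongrightarrow> 0 + 0"
    using min_rate_pos
    by (intro tendsto_add tendsto_zero_powrI lim_const_over_n tendsto_const) auto
  moreover have "\<exists>N. \<forall>b\<ge>N. measure \<mu> {x} \<le> (2 / real b) powr min_rate + 6 * max_rate / real b"
    using measure_point_le[OF assms] by blast
  ultimately have "measure \<mu> {x} \<le> 0 + 0"
    by (rule LIMSEQ_le_const)
  then show ?thesis
    using measure_nonneg[of \<mu> "{x}"] by simp
qed

text \<open>Accessibility of a point \<open>x\<close> of \<open>U\<close> bounds the expectation of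
  a tent around \<open>x\<close> from below by \<open>c / 2\<close> for all large \<open>n\<close>.
  The bound passes to the limit, where the tent lies below the indicator of
  \<open>U\<close>.\<close>

lemma full_support:
  assumes "openin (top_of_set prob_simplex) U" "U \<noteq> {}"
  shows "0 < measure \<mu> U"
proof -
  obtain T where T: "open T" "U = prob_simplex \<inter> T"
    using assms(1) by (auto simp: openin_open)
  obtain x where x: "x \<in> U" using assms(2) by auto
  obtain e where e: "0 < e" "ball x e \<subseteq> T"
    using T x openE by blast
  define f where "f y = max 0 (1 - dist y x / e)" for y
  have f: "continuous_on UNIV f"
    unfolding f_def using e(1) by (intro continuous_intros) auto
  have f1: "\<bar>f y\<bar> \<le> 1" for y
    using e(1) by (simp add: f_def)
  have U: "U \<in> sets \<mu>"
    unfolding sets_mu sets_restrict_space using T by auto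
  obtain c where c: "0 < c" "\<forall>\<^sub>F n in sequentially. c \<le> pr (\<lambda>s. dist (empirical s n) x < e / 2)"
    using accessible_simplex[of x] x T(2) e(1) unfolding accessible_def near_def
    by (auto dest!: spec[of _ "e / 2"])
  have "c / 2 \<le> (\<integral>y. f y \<partial>\<mu>)"
  proof (rule tendsto_lowerbound[OF limit_test[OF f f1]])
    show "\<forall>\<^sub>F n in sequentially. c / 2 \<le> (\<integral>\<omega>. f (empirical (\<lambda>k. X k \<omega>) n) \<partial>M)"
      using c(2)
    proof eventually_elim
      case (elim n)
      have "1 / 2 * pr (\<lambda>s. dist (empirical s n) x < e / 2) \<le> (\<integral>\<omega>. f (empirical (\<lambda>k. X k \<omega>) n) \<partial>M)"
      proof (rule integral_empirical_ge[OF f f1 _ hist_empirical[OF order.refl]])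
        fix s :: "nat \<Rightarrow> 'm"
        have "dist (empirical s n) x / e < 1 / 2" if "dist (empirical s n) x < e / 2"
          using that e(1) by (simp add: field_simps)
        moreover have "1 - dist (empirical s n) x / e \<le> f (empirical s n)" "0 \<le> f (empirical s n)"
          by (simp_all add: f_def)
        ultimately show "1 / 2 * of_bool (dist (empirical s n) x < e / 2) \<le> f (empirical s n)"
          by (cases "dist (empirical s n) x < e / 2") auto
      qed
      with elim show ?case by simp
    qed
  qed simp
  also have "\<dots> \<le> (\<integral>y. indicator U y \<partial>\<mu>)"
  proof (rule integral_mono)
    fix y assume y: "y \<in> space \<mu>"
    have "1 \<le> dist y x / e" if "y \<notin> U"
    proof -
      \<comment> \<open>The ball may leave the simplex, but \<open>y\<close> lies in it, and there
        \<open>U\<close> and \<open>T\<close> agree.\<close>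
      have "y \<notin> ball x e" using that y e(2) T(2) by (auto simp: space_mu)
      then show ?thesis using e(1) by (simp add: dist_commute field_simps)
    qed
    then show "f y \<le> indicator U y"
      using f1[of y] by (cases "y \<in> U") (auto simp: f_def)
  qed (use U integrable_test[OF f f1] in \<open>auto simp: integrable_indicator_iff less_top[symmetric]\<close>)
  also have "\<dots> = measure \<mu> U"
    using U by simp
  finally show ?thesis using c(1) by simp
qed

end

theorem theorem1p5:
  fixes G :: "real ^ 'm ^ 'm"
    and M :: "'w measure" and X :: "nat \<Rightarrow> 'w \<Rightarrow> 'm" and \<pi> :: "'m pmf"
    and \<mu> :: "(real ^ 'm) measure"
  assumes "CARD('m) \<ge> 2"
    and "G \<in> generators"
    and "markov_chain M X \<pi> (trans_matrix G)"
    and "limit_in_distribution prob_simplex M (occupation X) \<mu>"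
  shows "(\<forall>U. openin (top_of_set prob_simplex) U \<and> U \<noteq> {} \<longrightarrow> measure \<mu> U > 0) \<and>
         (\<forall>x\<in>prob_simplex. measure \<mu> {x} = 0)"
proof -
  interpret limiting_chain G M X \<pi> \<mu>
    using assms by unfold_locales
  show ?thesis
    using full_support no_atoms by blast
qed

end
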